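(* Let $a>0$ and $v_0\in L^2(\mathbb{R})$. The solution of the heat Cauchy problem associated to the real Euler operator $e^a_x=ax\frac{\partial}{\partial x}$, $$\begin{cases} e^a_x v(t,x)=\frac{\partial}{\partial t}v(t,x), & (t,x)\in(0,\infty)\times\mathbb{R},\\ v(0,x)=v_0(x), & x\in\mathbb{R},\end{cases}$$ is given by the formula $$v(t,x)=v_0(e^{at}x).$$ *)

theory Defs
  imports "HOL-Analysis.Analysis"
begin

text \<open>Membership of a representative in \<open>L\<^sup>2(\<real>)\<close>. We use the completed Lebesgue measure, so that
  membership depends only on the almost-everywhere class of the function.\<close>

definition in_L2 :: "(real \<Rightarrow> complex) \<Rightarrow> bool" where
  "in_L2 f \<longleftrightarrow> f \<in> borel_measurable lebesgue \<and> integrable lebesgue (\<lambda>x. (cmod (f x))\<^sup>2)"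

definition L2_norm :: "(real \<Rightarrow> complex) \<Rightarrow> real" where
  "L2_norm f = sqrt (LINT x|lebesgue. (cmod (f x))\<^sup>2)"

text \<open>Test functions: the space \<open>C\<^sub>c\<^sup>\<infinity>(\<real>)\<close>. Real-valued ones suffice, also against
  complex-valued functions, by linearity.\<close>

definition test_function :: "(real \<Rightarrow> real) \<Rightarrow> bool" where
  "test_function \<phi> \<longleftrightarrow>
     (\<forall>n. (deriv ^^ n) \<phi> differentiable_on UNIV) \<and> compact (closure {x. \<phi> x \<noteq> 0})"

text \<open>Distributions on \<open>\<real>\<close> are represented by their action on test functions; values at other
  arguments are irrelevant.\<close>

type_synonym distribution = "(real \<Rightarrow> real) \<Rightarrow> complex"

definition distr_of :: "(real \<Rightarrow> complex) \<Rightarrow> distribution" where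
  "distr_of f = (\<lambda>\<phi>. LINT x|lebesgue. f x * complex_of_real (\<phi> x))"

definition distr_deriv :: "distribution \<Rightarrow> distribution" where
  "distr_deriv T = (\<lambda>\<phi>. - T (deriv \<phi>))"

definition distr_mult :: "(real \<Rightarrow> real) \<Rightarrow> distribution \<Rightarrow> distribution" where
  "distr_mult m T = (\<lambda>\<phi>. T (\<lambda>x. m x * \<phi> x))"

text \<open>The real Euler operator \<open>a x (\<partial>/\<partial>x)\<close>, acting on distributions.\<close>

definition euler_op :: "real \<Rightarrow> distribution \<Rightarrow> distribution" where
  "euler_op a T = distr_mult (\<lambda>x. a * x) (distr_deriv T)"

text \<open>For \<open>v\<^sub>0 \<in> L\<^sup>2(\<real>)\<close> the Cauchy problem has in general no pointwise meaning, so solutions are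
  taken in the class \<open>C([0,\<infinity>); L\<^sup>2(\<real>))\<close>: the equation is an identity between distributions on \<open>\<real>\<close>
  for each \<open>t > 0\<close>, with the time derivative taken in the (weak) topology of distributions, and the
  initial condition is an identity in \<open>L\<^sup>2(\<real>)\<close>. The values of \<open>v t\<close> for \<open>t < 0\<close> play no role.\<close>

definition heat_cauchy_solution ::
  "real \<Rightarrow> (real \<Rightarrow> complex) \<Rightarrow> (real \<Rightarrow> real \<Rightarrow> complex) \<Rightarrow> bool" where
  "heat_cauchy_solution a v0 v \<longleftrightarrow>
     (\<forall>t\<ge>0. in_L2 (v t)) \<and>
     (\<forall>t\<ge>0. ((\<lambda>s. L2_norm (\<lambda>x. v s x - v t x)) \<longlongrightarrow> 0) (at t within {0..})) \<and>
     (\<forall>t>0. \<forall>\<phi>. test_function \<phi> \<longrightarrow>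
        ((\<lambda>s. distr_of (v s) \<phi>) has_vector_derivative euler_op a (distr_of (v t)) \<phi>) (at t)) \<and>
     (AE x in lebesgue. v 0 x = v0 x)"

end

theory Submission
  imports Defs
begin

text \<open>
  The proof is the method of characteristics, carried out on the side of the test functions. For a
  test function \<open>\<phi>\<close> and a rate \<open>b\<close> put \<open>\<phi>\<^sub>s(x) = e\<^bsup>bs\<^esup> \<phi>(e\<^bsup>bs\<^esup> x)\<close>; this is the constant
  \<open>dilation b \<phi> s\<close> below. It solves \<open>\<partial>\<phi>\<^sub>s/\<partial>s = b (x \<phi>\<^sub>s)'\<close>, which for \<open>b = a\<close> is the equation
  adjoint to the heat equation of the Euler operator. The \<open>s\<close>-derivative may be taken under the
  integral sign in \<open>\<integral> w \<phi>\<^sub>s\<close> for every locally integrable \<open>w\<close> (\<open>distr_of_dilation_has_derivative\<close>).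

  Existence: substituting \<open>y = e\<^bsup>as\<^esup> x\<close> turns \<open>\<integral> v\<^sub>0(e\<^bsup>as\<^esup> x) \<phi>(x) dx\<close> into \<open>\<integral> v\<^sub>0 \<phi>\<^sub>s\<close> with
  \<open>b = -a\<close>, so the equation holds. Strong continuity in \<open>L\<^sup>2\<close> is clear for continuous functions of
  compact support, by dominated convergence. These are dense, and a dilation by a factor at least 1
  does not increase the norm, so it carries over to all of \<open>L\<^sup>2\<close> (\<open>dilation_L2_continuous\<close>).

  Uniqueness: let \<open>v\<close> be a solution, \<open>\<phi>\<close> a test function and \<open>b = a\<close>. In the derivative of
  \<open>s \<mapsto> \<integral> v(s) \<phi>\<^sub>s\<close> the contribution of \<open>v\<close> and that of \<open>\<phi>\<^sub>s\<close> cancel. The second-order term of the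
  product rule is negligible because \<open>s \<mapsto> \<phi>\<^sub>s\<close> is Lipschitz with values in the bounded functions
  supported in a fixed interval, and \<open>v\<close> is continuous in \<open>L\<^sup>2\<close>. So the pairing is constant on
  \<open>[0,\<infinity>)\<close> (\<open>heat_solution_pairing_constant\<close>). Undoing the dilation, \<open>v(t)\<close> and \<open>v\<^sub>0(e\<^bsup>at\<^esup> \<cdot>)\<close> have
  the same integral against every test function. They agree almost everywhere by the fundamental
  lemma of the calculus of variations (\<open>AE_eq_0_if_test_integrals_eq_0\<close>).
\<close>

section \<open>Smooth functions and test functions\<close>

text \<open>Being \<open>n\<close> times differentiable on the whole line. The recursion on an arbitrary derivative \<open>f'\<close>,
  rather than on iterates of \<open>deriv\<close>, reduces the closure properties to short inductions.\<close>

fun times_differentiable :: "nat \<Rightarrow> (real \<Rightarrow> real) \<Rightarrow> bool" where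
  "times_differentiable 0 f \<longleftrightarrow> True"
| "times_differentiable (Suc n) f \<longleftrightarrow>
     (\<exists>f'. (\<forall>x. (f has_real_derivative f' x) (at x)) \<and> times_differentiable n f')"

lemma times_differentiable_SucI:
  assumes "\<And>x. (f has_real_derivative f' x) (at x)" and "times_differentiable n f'"
  shows "times_differentiable (Suc n) f"
  using assms by auto

lemma times_differentiable_Suc_deriv:
  "times_differentiable (Suc n) f \<longleftrightarrow> f differentiable_on UNIV \<and> times_differentiable n (deriv f)"
proof
  assume "times_differentiable (Suc n) f"
  then obtain f' where f': "\<And>x. (f has_real_derivative f' x) (at x)" "times_differentiable n f'"
    by auto
  then have "deriv f = f'"
    by (auto intro: DERIV_imp_deriv)
  with f' show "f differentiable_on UNIV \<and> times_differentiable n (deriv f)"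
    by (auto simp: differentiable_on_def real_differentiable_def)
next
  assume "f differentiable_on UNIV \<and> times_differentiable n (deriv f)"
  then show "times_differentiable (Suc n) f"
    by (intro times_differentiable_SucI[of f "deriv f"])
       (auto simp: differentiable_on_def DERIV_deriv_iff_real_differentiable)
qed

lemma all_derivs_differentiable_iff:
  "(\<forall>n. (deriv ^^ n) f differentiable_on UNIV) \<longleftrightarrow> (\<forall>n. times_differentiable n f)"
proof -
  have "times_differentiable n f \<longleftrightarrow> (\<forall>k<n. (deriv ^^ k) f differentiable_on UNIV)" for n
  proof (induction n arbitrary: f)
    case (Suc n)
    show ?case
      unfolding times_differentiable_Suc_deriv Suc.IH
      by (simp add: All_less_Suc2 funpow_swap1)
  qed simp
  then show ?thesis
    by blast
qed

lemma times_differentiable_mono_Suc: "times_differentiable (Suc n) f \<Longrightarrow> times_differentiable n f"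
  by (induction n arbitrary: f) force+

lemma times_differentiable_const: "times_differentiable n (\<lambda>x. c)"
proof (induction n arbitrary: c)
  case (Suc n)
  show ?case
    by (rule times_differentiable_SucI[where f' = "\<lambda>x. 0"]) (auto intro!: derivative_eq_intros Suc)
qed simp

lemma times_differentiable_add:
  "times_differentiable n f \<Longrightarrow> times_differentiable n g \<Longrightarrow> times_differentiable n (\<lambda>x. f x + g x)"
proof (induction n arbitrary: f g)
  case (Suc n)
  then obtain f' g' where
    "\<And>x. (f has_real_derivative f' x) (at x)" "times_differentiable n f'"
    "\<And>x. (g has_real_derivative g' x) (at x)" "times_differentiable n g'"
    by auto
  then show ?case
    by (intro times_differentiable_SucI[where f' = "\<lambda>x. f' x + g' x"])
       (auto intro!: derivative_intros Suc.IH)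
qed simp

lemma times_differentiable_mult:
  "times_differentiable n f \<Longrightarrow> times_differentiable n g \<Longrightarrow> times_differentiable n (\<lambda>x. f x * g x)"
proof (induction n arbitrary: f g)
  case (Suc n)
  then obtain f' g' where
    *: "\<And>x. (f has_real_derivative f' x) (at x)" "times_differentiable n f'"
    "\<And>x. (g has_real_derivative g' x) (at x)" "times_differentiable n g'"
    by auto
  have "times_differentiable n f" "times_differentiable n g"
    using Suc.prems times_differentiable_mono_Suc by blast+
  with * show ?case
    by (intro times_differentiable_SucI[where f' = "\<lambda>x. f x * g' x + f' x * g x"]
          times_differentiable_add Suc.IH)
       (auto intro!: derivative_eq_intros)
qed simp

lemma times_differentiable_affine:
  "times_differentiable n f \<Longrightarrow> times_differentiable n (\<lambda>x. f (m * x + c))"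
proof (induction n arbitrary: f)
  case (Suc n)
  then obtain f' where *: "\<And>x. (f has_real_derivative f' x) (at x)" "times_differentiable n f'"
    by auto
  have "((\<lambda>x. f (m * x + c)) has_real_derivative m * f' (m * x + c)) (at x)" for x
  proof -
    have "((\<lambda>x. m * x + c) has_real_derivative m) (at x)"
      by (auto intro!: derivative_eq_intros)
    from DERIV_chain2[OF *(1) this] show ?thesis
      by (simp add: mult.commute)
  qed
  then show ?case
    using * by (intro times_differentiable_SucI[where f' = "\<lambda>x. m * f' (m * x + c)"]
          times_differentiable_mult times_differentiable_const Suc.IH)
qed simp

lemma test_function_iff:
  "test_function \<phi> \<longleftrightarrow> (\<forall>n. times_differentiable n \<phi>) \<and> (\<exists>R. \<forall>x. \<bar>x\<bar> > R \<longrightarrow> \<phi> x = 0)"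
proof -
  have "compact (closure {x. \<phi> x \<noteq> 0}) \<longleftrightarrow> bounded {x. \<phi> x \<noteq> 0}"
    by (simp add: compact_closure)
  also have "\<dots> \<longleftrightarrow> (\<exists>R. \<forall>x. \<bar>x\<bar> > R \<longrightarrow> \<phi> x = 0)"
    by (auto simp: bounded_iff not_less[symmetric])
  finally show ?thesis
    by (simp add: test_function_def all_derivs_differentiable_iff)
qed

text \<open>What the estimates use of a test function: one radius \<open>R\<close> and one bound \<open>B\<close> that serve both the
  function and its derivative.\<close>

lemma test_functionE:
  assumes "test_function \<phi>"
  obtains R B where "R > 0" "B > 0"
    "\<And>x. (\<phi> has_real_derivative deriv \<phi> x) (at x)" "continuous_on UNIV (deriv \<phi>)"
    "\<And>x. \<bar>x\<bar> > R \<Longrightarrow> \<phi> x = 0" "\<And>x. \<bar>\<phi> x\<bar> \<le> B" "\<And>x. \<bar>deriv \<phi> x\<bar> \<le> B"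
    "\<And>x. \<bar>x\<bar> > R \<Longrightarrow> deriv \<phi> x = 0"
proof -
  obtain R0 where R0: "\<And>x. \<bar>x\<bar> > R0 \<Longrightarrow> \<phi> x = 0"
    using assms by (auto simp: test_function_iff)
  define R where "R = max R0 1"
  have R: "\<phi> x = 0" if "\<bar>x\<bar> > R" for x
    using R0 that by (auto simp: R_def)
  have "times_differentiable (Suc (Suc 0)) \<phi>"
    using assms by (auto simp: test_function_iff simp del: times_differentiable.simps)
  then have d: "\<phi> differentiable_on UNIV" "deriv \<phi> differentiable_on UNIV"
    unfolding times_differentiable_Suc_deriv by auto
  then have D: "(\<phi> has_real_derivative deriv \<phi> x) (at x)" for x
    by (auto simp: differentiable_on_def DERIV_deriv_iff_real_differentiable)
  have D0: "deriv \<phi> x = 0" if "\<bar>x\<bar> > R" for x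
  proof -
    have "open {x. \<bar>x\<bar> > R}"
      by (intro open_Collect_less continuous_intros)
    then have "((\<lambda>x. 0) has_real_derivative deriv \<phi> x) (at x)"
      using D[of x] that R by (rule_tac has_field_derivative_transform_within_open[of \<phi>]) auto
    then show ?thesis
      using DERIV_unique DERIV_const by blast
  qed
  have c: "continuous_on UNIV \<phi>" "continuous_on UNIV (deriv \<phi>)"
    using d by (auto intro: differentiable_imp_continuous_on)
  have bd: "\<exists>B. \<forall>x\<in>{-R..R}. \<bar>f x\<bar> \<le> B" if "continuous_on UNIV f" for f :: "real \<Rightarrow> real"
  proof -
    have "bounded (f ` {-R..R})"
      by (intro compact_imp_bounded compact_continuous_image continuous_on_subset[OF that]) auto
    then show ?thesis by (auto simp: bounded_iff)
  qed
  obtain B1 where B1: "\<And>x. x \<in> {-R..R} \<Longrightarrow> \<bar>\<phi> x\<bar> \<le> B1"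
    using bd[OF c(1)] by blast
  obtain B2 where B2: "\<And>x. x \<in> {-R..R} \<Longrightarrow> \<bar>deriv \<phi> x\<bar> \<le> B2"
    using bd[OF c(2)] by blast
  define B where "B = max 1 (max B1 B2)"
  have "\<bar>\<phi> x\<bar> \<le> B" "\<bar>deriv \<phi> x\<bar> \<le> B" for x
    using B1[of x] B2[of x] R[of x] D0[of x] by (auto simp: B_def abs_le_iff not_less) linarith+
  then show thesis
    using that[of R B] D c R D0 by (auto simp: R_def B_def)
qed

lemma test_function_has_derivative:
  "test_function \<phi> \<Longrightarrow> (\<phi> has_real_derivative deriv \<phi> x) (at x)"
  by (rule test_functionE) auto

lemma test_function_deriv: "test_function \<phi> \<Longrightarrow> test_function (deriv \<phi>)"
proof -
  assume a: "test_function \<phi>"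
  have "times_differentiable n (deriv \<phi>)" for n
    using a times_differentiable_Suc_deriv unfolding test_function_iff by blast
  moreover obtain R where "\<And>x. \<bar>x\<bar> > R \<Longrightarrow> deriv \<phi> x = 0"
    using test_functionE[OF a] by metis
  ultimately show ?thesis
    unfolding test_function_iff by blast
qed

text \<open>The function \<open>x\<^bsup>-k\<^esup> e\<^bsup>-1/x\<^esup>\<close> on the positive half-line, extended by 0. The powers of \<open>1/x\<close> are
  included because the family, unlike \<open>e\<^bsup>-1/x\<^esup>\<close> alone, is closed under differentiation up to
  linear combinations.\<close>

definition flat_exp :: "nat \<Rightarrow> real \<Rightarrow> real" where
  "flat_exp k x = (if x > 0 then inverse x ^ k * exp (- inverse x) else 0)"

lemma flat_exp_tendsto_0: "(flat_exp k \<longlongrightarrow> 0) (at 0)"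
proof -
  have "((\<lambda>x. inverse x ^ k / exp (inverse x :: real)) \<longlongrightarrow> 0) (at_right 0)"
    by (rule filterlim_compose[OF tendsto_power_div_exp_0 filterlim_inverse_at_top_right])
  moreover have "\<forall>\<^sub>F x in at_right 0. inverse x ^ k / exp (inverse x :: real) = flat_exp k x"
    by (auto simp: eventually_at_filter flat_exp_def exp_minus divide_inverse)
  ultimately have "(flat_exp k \<longlongrightarrow> 0) (at_right 0)"
    by (rule Lim_transform_eventually)
  moreover have "(flat_exp k \<longlongrightarrow> 0) (at_left 0)"
    by (rule tendsto_eventually) (auto simp: eventually_at_filter flat_exp_def)
  ultimately show ?thesis
    by (simp add: filterlim_split_at)
qed

lemma flat_exp_has_derivative:
  "(flat_exp k has_real_derivative flat_exp (k + 2) x - real k * flat_exp (k + 1) x) (at x)"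
proof (cases x "0 :: real" rule: linorder_cases)
  case less
  have "((\<lambda>x. 0) has_real_derivative 0) (at x)"
    by simp
  then have "(flat_exp k has_real_derivative 0) (at x)"
    by (rule has_field_derivative_transform_within_open[where S = "{..<0}"]) (use less in \<open>auto simp: flat_exp_def\<close>)
  then show ?thesis
    using less by (simp add: flat_exp_def)
next
  case greater
  have "((\<lambda>x. inverse x ^ k * exp (- inverse x)) has_real_derivative
          inverse x ^ (k + 2) * exp (- inverse x) - real k * (inverse x ^ (k + 1) * exp (- inverse x))) (at x)"
  proof -
    have "(inverse has_real_derivative - (inverse x)\<^sup>2) (at x)"
      using greater by (auto intro!: derivative_eq_intros simp: power2_eq_square)
    from DERIV_mult[OF DERIV_power[OF this, of k] DERIV_fun_exp[OF DERIV_minus[OF this]]] show ?thesis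
      by (cases k) (simp_all add: algebra_simps power2_eq_square)
  qed
  then have "(flat_exp k has_real_derivative
          inverse x ^ (k + 2) * exp (- inverse x) - real k * (inverse x ^ (k + 1) * exp (- inverse x))) (at x)"
    by (rule has_field_derivative_transform_within_open[where S = "{0<..}"]) (use greater in \<open>auto simp: flat_exp_def\<close>)
  then show ?thesis
    using greater by (simp add: flat_exp_def)
next
  case equal
  \<comment> \<open>The difference quotient at 0 is the next member of the family.\<close>
  have "(\<lambda>h. (flat_exp k (0 + h) - flat_exp k 0) / h) = flat_exp (k + 1)"
    by (auto simp: flat_exp_def fun_eq_iff field_simps)
  then have "(flat_exp k has_real_derivative 0) (at 0)"
    using flat_exp_tendsto_0 unfolding DERIV_def by simp
  then show ?thesis
    using equal by (simp add: flat_exp_def)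
qed

lemma times_differentiable_flat_exp: "times_differentiable n (flat_exp k)"
proof (induction n arbitrary: k)
  case (Suc n)
  have "times_differentiable n (\<lambda>x. flat_exp (k + 2) x + (- real k) * flat_exp (k + 1) x)"
    by (intro times_differentiable_add times_differentiable_mult times_differentiable_const Suc)
  then show ?case
    by (intro times_differentiable_SucI[OF flat_exp_has_derivative]) simp
qed simp

text \<open>Smooth functions with values in \<open>[0,1]\<close> that vanish outside \<open>(c,d)\<close> and, as \<open>n\<close> tends to infinity,
  converge pointwise to the indicator of \<open>(c,d)\<close>: on that interval and for
  \<open>n > 0\<close>, \<open>bump c d n x\<close> is \<open>exp (-(1/n) (1/(x-c) + 1/(d-x)))\<close>.\<close>

definition bump :: "real \<Rightarrow> real \<Rightarrow> nat \<Rightarrow> real \<Rightarrow> real" where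
  "bump c d n x = flat_exp 0 (real n * (x - c)) * flat_exp 0 (real n * (d - x))"

lemma test_function_bump: "test_function (bump c d n)"
proof -
  have "times_differentiable m (\<lambda>x. flat_exp 0 (real n * x + - real n * c) * flat_exp 0 (- real n * x + real n * d))" for m
    by (intro times_differentiable_mult times_differentiable_affine times_differentiable_flat_exp)
  then have "times_differentiable m (bump c d n)" for m
    by (simp add: bump_def[abs_def] algebra_simps)
  moreover have "\<forall>x. \<bar>x\<bar> > \<bar>c\<bar> + \<bar>d\<bar> \<longrightarrow> bump c d n x = 0"
    by (auto simp: bump_def flat_exp_def zero_less_mult_iff)
  ultimately show ?thesis
    unfolding test_function_iff by blast
qed

lemma bump_bounds: "0 \<le> bump c d n x" "bump c d n x \<le> indicator {c..d} x"
  by (auto simp: bump_def flat_exp_def indicator_def zero_less_mult_iff intro!: mult_le_one)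

lemma bump_tendsto: "(\<lambda>n. bump c d n x) \<longlonglongrightarrow> indicator {c<..<d} x"
proof (cases "x \<in> {c<..<d}")
  case True
  have lim: "(\<lambda>n. flat_exp 0 (real n * y)) \<longlonglongrightarrow> 1" if "y > 0" for y
  proof -
    have "(\<lambda>n. exp (- (inverse (real n) * inverse y))) \<longlonglongrightarrow> exp (- (0 * inverse y))"
      by (intro tendsto_intros lim_inverse_n)
    moreover have "\<forall>\<^sub>F n in sequentially. exp (- (inverse (real n) * inverse y)) = flat_exp 0 (real n * y)"
      using eventually_gt_at_top[of 0] by eventually_elim (use that in \<open>auto simp: flat_exp_def\<close>)
    ultimately show ?thesis
      using Lim_transform_eventually by fastforce
  qed
  show ?thesis
    using tendsto_mult[OF lim lim, of "x - c" "d - x"] True by (simp add: bump_def)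
next
  case False
  then have "bump c d n x = 0" for n
    by (auto simp: bump_def flat_exp_def zero_less_mult_iff)
  with False show ?thesis
    by simp
qed

section \<open>The fundamental lemma of the calculus of variations\<close>

text \<open>Lebesgue integrability on every bounded interval; symmetric intervals suffice.\<close>

definition locally_integrable :: "(real \<Rightarrow> complex) \<Rightarrow> bool" where
  "locally_integrable w \<longleftrightarrow> (\<forall>R. set_integrable lebesgue {-R..R} w)"

lemma locally_integrable_interval:
  assumes "locally_integrable w"
  shows "set_integrable lebesgue {c..d} w"
proof (rule set_integrable_subset)
  show "set_integrable lebesgue {- (\<bar>c\<bar> + \<bar>d\<bar>)..\<bar>c\<bar> + \<bar>d\<bar>} w"
    using assms unfolding locally_integrable_def by blast
qed auto

lemma interval_integral_eq_0_if_test_integrals_eq_0: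
  fixes w :: "real \<Rightarrow> complex"
  assumes w: "locally_integrable w"
    and zero: "\<And>\<phi>. test_function \<phi> \<Longrightarrow> (LINT x|lebesgue. w x * complex_of_real (\<phi> x)) = 0"
  shows "integral {c..d} w = 0"
proof -
  define f where "f = (\<lambda>x. indicator {c..d} x *\<^sub>R w x)"
  have f: "integrable lebesgue f"
    using locally_integrable_interval[OF w] unfolding set_integrable_def f_def by blast
  have bump_meas: "(\<lambda>x. complex_of_real (bump c d n x)) \<in> borel_measurable lebesgue" for n
  proof -
    have "(bump c d n has_real_derivative deriv (bump c d n) x) (at x)" for x
      by (rule test_function_has_derivative[OF test_function_bump])
    then have "continuous_on UNIV (bump c d n)"
      by (meson DERIV_continuous_on has_field_derivative_at_within)
    then have "bump c d n \<in> borel_measurable borel"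
      by (rule borel_measurable_continuous_onI)
    then show ?thesis
      by (intro measurable_completion) simp
  qed
  \<comment> \<open>The bump functions live on \<open>{c..d}\<close>, where \<open>w\<close> and \<open>f\<close> agree, so \<open>f\<close> dominates the sequence.\<close>
  have "(\<lambda>n. LINT x|lebesgue. f x * complex_of_real (bump c d n x))
          \<longlonglongrightarrow> (LINT x|lebesgue. f x * complex_of_real (indicator {c<..<d} x))"
  proof (rule integral_dominated_convergence)
    show "integrable lebesgue (\<lambda>x. norm (f x))"
      using f by (rule integrable_norm)
    show "AE x in lebesgue. norm (f x * complex_of_real (bump c d n x)) \<le> norm (f x)" for n
    proof (intro AE_I2)
      fix x
      have "\<bar>bump c d n x\<bar> \<le> 1"
        using bump_bounds[of c d n x] by (cases "x \<in> {c..d}") auto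
      then show "norm (f x * complex_of_real (bump c d n x)) \<le> norm (f x)"
        by (simp add: norm_mult mult_left_le)
    qed
    show "AE x in lebesgue. (\<lambda>n. f x * complex_of_real (bump c d n x))
            \<longlonglongrightarrow> f x * complex_of_real (indicator {c<..<d} x)"
      by (intro AE_I2 tendsto_intros bump_tendsto)
    show "(\<lambda>x. f x * complex_of_real (bump c d n x)) \<in> borel_measurable lebesgue" for n
      using borel_measurable_integrable[OF f] bump_meas by (rule borel_measurable_times)
    show "(\<lambda>x. f x * complex_of_real (indicator {c<..<d} x)) \<in> borel_measurable lebesgue"
      by (intro borel_measurable_times borel_measurable_integrable[OF f] measurable_completion) auto
  qed
  moreover have "(LINT x|lebesgue. f x * complex_of_real (bump c d n x)) = 0" for n
  proof -
    have "f x * complex_of_real (bump c d n x) = w x * complex_of_real (bump c d n x)" for x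
      using bump_bounds[of c d n x] by (auto simp: f_def indicator_def split: if_splits)
    then show ?thesis
      by (simp only: zero[OF test_function_bump])
  qed
  ultimately have "(LINT x|lebesgue. f x * complex_of_real (indicator {c<..<d} x)) = 0"
    using LIMSEQ_unique[OF tendsto_const] by fastforce
  also have "(LINT x|lebesgue. f x * complex_of_real (indicator {c<..<d} x)) = (LINT x|lebesgue. f x)"
  proof (rule integral_cong_AE)
    have "negligible {c, d}"
      by simp
    then have "AE x in lebesgue. x \<notin> {c, d}"
      by (intro AE_not_in) (simp add: negligible_iff_null_sets)
    then show "AE x in lebesgue. f x * complex_of_real (indicator {c<..<d} x) = f x"
      by eventually_elim (auto simp: f_def indicator_def)
    show "(\<lambda>x. f x * complex_of_real (indicator {c<..<d} x)) \<in> borel_measurable lebesgue"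
      by (intro borel_measurable_times borel_measurable_integrable[OF f] measurable_completion) auto
  qed (rule borel_measurable_integrable[OF f])
  also have "\<dots> = integral {c..d} w"
    using set_lebesgue_integral_eq_integral(2)[OF locally_integrable_interval[OF w]]
    unfolding f_def set_lebesgue_integral_def .
  finally show ?thesis .
qed

text \<open>Testing with bump functions shows that the integral over every bounded interval vanishes; by
  Lebesgue differentiation the function itself then vanishes almost everywhere.\<close>

lemma AE_eq_0_if_test_integrals_eq_0:
  fixes w :: "real \<Rightarrow> complex"
  assumes w: "locally_integrable w"
    and zero: "\<And>\<phi>. test_function \<phi> \<Longrightarrow> (LINT x|lebesgue. w x * complex_of_real (\<phi> x)) = 0"
  shows "AE x in lebesgue. w x = 0"
proof -
  have "w integrable_on cbox c d" for c d
    using set_lebesgue_integral_eq_integral(1)[OF locally_integrable_interval[OF w]] by simp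
  then obtain N where N: "negligible N" and
    lim: "\<And>x e. \<lbrakk>x \<notin> N; 0 < e\<rbrakk> \<Longrightarrow> \<exists>d>0. \<forall>h. 0 < h \<and> h < d \<longrightarrow>
            norm (integral (cbox x (x + h *\<^sub>R One)) w /\<^sub>R h ^ DIM(real) - w x) < e"
    using integrable_ccontinuous_explicit[of w] by blast
  have w0: "w x = 0" if x: "x \<notin> N" for x
  proof (rule ccontr)
    assume "w x \<noteq> 0"
    then obtain d where "d > 0" and
      "\<And>h. 0 < h \<Longrightarrow> h < d \<Longrightarrow> norm (integral (cbox x (x + h *\<^sub>R One)) w /\<^sub>R h ^ DIM(real) - w x) < norm (w x)"
      using lim[OF x, of "norm (w x)"] unfolding zero_less_norm_iff by blast
    from this(2)[of "d / 2"] \<open>d > 0\<close> show False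
      using interval_integral_eq_0_if_test_integrals_eq_0[OF w zero] by simp
  qed
  have "AE x in lebesgue. x \<notin> N"
    using N by (intro AE_not_in) (simp add: negligible_iff_null_sets)
  then show ?thesis
    by eventually_elim (rule w0)
qed

section \<open>Dilations of test functions\<close>

lemma dominated_convergence_within:
  fixes f :: "real \<Rightarrow> 'a \<Rightarrow> 'b::{banach, second_countable_topology}"
  assumes "\<And>s. s \<in> S - {t} \<Longrightarrow> f s \<in> borel_measurable M" and "g \<in> borel_measurable M"
    and "integrable M h"
    and "\<And>s x. s \<in> S - {t} \<Longrightarrow> norm (f s x) \<le> h x"
    and "\<And>x. ((\<lambda>s. f s x) \<longlongrightarrow> g x) (at t within S)"
  shows "((\<lambda>s. LINT x|M. f s x) \<longlongrightarrow> (LINT x|M. g x)) (at t within S)"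
  unfolding tendsto_at_iff_sequentially comp_def
proof (intro allI impI)
  fix X assume X: "\<forall>i. X i \<in> S - {t}" "X \<longlonglongrightarrow> t"
  show "(\<lambda>i. LINT x|M. f (X i) x) \<longlonglongrightarrow> (LINT x|M. g x)"
  proof (rule integral_dominated_convergence[where w = h])
    show "AE x in M. (\<lambda>i. f (X i) x) \<longlonglongrightarrow> g x"
      using assms(5) X unfolding tendsto_at_iff_sequentially comp_def by blast
  qed (use assms X in auto)
qed

lemma integrable_times_bounded_support:
  assumes w: "locally_integrable w" and g: "g \<in> borel_measurable lebesgue"
    and bound: "\<And>y. \<bar>g y\<bar> \<le> C * indicator {-R..R} y"
  shows "integrable lebesgue (\<lambda>y. w y * complex_of_real (g y))"
proof -
  define f where "f = (\<lambda>y. indicator {-R..R} y *\<^sub>R w y)"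
  have f: "integrable lebesgue f"
    using w unfolding locally_integrable_def set_integrable_def f_def by blast
  have eq: "w y * complex_of_real (g y) = f y * complex_of_real (g y)" for y
    using bound[of y] by (cases "y \<in> {-R..R}") (auto simp: f_def)
  have "integrable lebesgue (\<lambda>y. f y * complex_of_real (g y))"
  proof (rule Bochner_Integration.integrable_bound)
    show "integrable lebesgue (\<lambda>y. C *\<^sub>R f y)"
      using f by simp
    show "(\<lambda>y. f y * complex_of_real (g y)) \<in> borel_measurable lebesgue"
      using borel_measurable_integrable[OF f] g by simp
    have "norm (f y * complex_of_real (g y)) \<le> norm (C *\<^sub>R f y)" for y
    proof -
      have "\<bar>g y\<bar> \<le> \<bar>C\<bar>"
        using bound[of y] by (cases "y \<in> {-R..R}") auto
      then show ?thesis
        by (simp add: norm_mult mult.commute mult_right_mono)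
    qed
    then show "AE y in lebesgue. norm (f y * complex_of_real (g y)) \<le> norm (C *\<^sub>R f y)"
      by simp
  qed
  then show ?thesis
    by (simp only: eq)
qed

text \<open>The dilation \<open>\<phi>\<^sub>s(y) = e\<^bsup>bs\<^esup> \<phi>(e\<^bsup>bs\<^esup> y)\<close> with rate \<open>b\<close>, normalised to preserve the integral.\<close>

definition dilation :: "real \<Rightarrow> (real \<Rightarrow> real) \<Rightarrow> real \<Rightarrow> real \<Rightarrow> real" where
  "dilation b \<phi> s y = exp (b * s) * \<phi> (exp (b * s) * y)"

lemma test_function_dilation: "test_function \<phi> \<Longrightarrow> test_function (dilation b \<phi> s)"
proof -
  assume \<phi>: "test_function \<phi>"
  have "times_differentiable n (\<lambda>y. exp (b * s) * \<phi> (exp (b * s) * y + 0))" for n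
    by (intro times_differentiable_mult times_differentiable_const times_differentiable_affine)
       (use \<phi> in \<open>simp add: test_function_iff\<close>)
  then have "times_differentiable n (dilation b \<phi> s)" for n
    by (simp add: dilation_def[abs_def])
  moreover obtain R where R: "\<And>x. \<bar>x\<bar> > R \<Longrightarrow> \<phi> x = 0"
    using \<phi> by (auto simp: test_function_iff)
  have "\<forall>y. \<bar>y\<bar> > R / exp (b * s) \<longrightarrow> dilation b \<phi> s y = 0"
    by (auto simp: dilation_def R abs_mult field_simps)
  ultimately show ?thesis
    unfolding test_function_iff by blast
qed

lemma test_function_measurable: "test_function \<phi> \<Longrightarrow> \<phi> \<in> borel_measurable lebesgue"
proof -
  assume "test_function \<phi>"
  then have "continuous_on UNIV \<phi>"
    by (meson test_function_has_derivative DERIV_continuous_on has_field_derivative_at_within)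
  then show ?thesis
    by (intro measurable_completion) (simp add: borel_measurable_continuous_onI)
qed

lemma deriv_dilation:
  assumes "test_function \<phi>"
  shows "(dilation b \<phi> s has_real_derivative (exp (b * s))\<^sup>2 * deriv \<phi> (exp (b * s) * y)) (at y)"
proof -
  have "((\<lambda>y. exp (b * s) * y) has_real_derivative exp (b * s)) (at y)"
    by (auto intro!: derivative_eq_intros)
  from DERIV_chain2[OF test_function_has_derivative[OF assms] this]
  have "((\<lambda>y. \<phi> (exp (b * s) * y)) has_real_derivative deriv \<phi> (exp (b * s) * y) * exp (b * s)) (at y)" .
  then show ?thesis
    unfolding dilation_def[abs_def]
    by (auto intro!: derivative_eq_intros simp: power2_eq_square)
qed

lemma has_derivative_id_times_dilation:
  assumes "test_function \<phi>"
  shows "((\<lambda>x. x * dilation b \<phi> s x) has_real_derivative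
          dilation b \<phi> s y + y * ((exp (b * s))\<^sup>2 * deriv \<phi> (exp (b * s) * y))) (at y)"
  using DERIV_mult[OF DERIV_ident deriv_dilation[OF assms]] by (simp add: algebra_simps)

text \<open>The transport equation \<open>\<partial>\<phi>\<^sub>s/\<partial>s = b (y \<phi>\<^sub>s)'\<close>.\<close>

lemma dilation_time_derivative:
  assumes "test_function \<phi>"
  shows "((\<lambda>s. dilation b \<phi> s y) has_real_derivative b * deriv (\<lambda>x. x * dilation b \<phi> s x) y) (at s)"
proof -
  note \<phi> = test_function_has_derivative[OF assms]
  have E: "((\<lambda>s. exp (b * s)) has_real_derivative b * exp (b * s)) (at s)"
    by (auto intro!: derivative_eq_intros)
  have "((\<lambda>s. exp (b * s) * y) has_real_derivative b * exp (b * s) * y) (at s)"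
    by (auto intro!: derivative_eq_intros)
  from DERIV_mult[OF E DERIV_chain2[OF \<phi> this]]
  have "((\<lambda>s. dilation b \<phi> s y) has_real_derivative
          b * (dilation b \<phi> s y + y * ((exp (b * s))\<^sup>2 * deriv \<phi> (exp (b * s) * y)))) (at s)"
    by (simp add: dilation_def algebra_simps power2_eq_square)
  moreover have "((\<lambda>x. x * dilation b \<phi> s x) has_real_derivative
          dilation b \<phi> s y + y * ((exp (b * s))\<^sup>2 * deriv \<phi> (exp (b * s) * y))) (at y)"
    by (rule has_derivative_id_times_dilation[OF assms])
  ultimately show ?thesis
    by (simp add: DERIV_imp_deriv)
qed

lemma test_function_euler:
  assumes "test_function \<phi>"
  shows "test_function (deriv (\<lambda>x. x * \<phi> x))"
proof (rule test_function_deriv)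
  have "times_differentiable n (\<lambda>x. x)" for n
    using times_differentiable_SucI[OF DERIV_ident times_differentiable_const[of "n" 1]]
    by (rule times_differentiable_mono_Suc)
  then show "test_function (\<lambda>x. x * \<phi> x)"
    using assms times_differentiable_mult unfolding test_function_iff by fastforce
qed

text \<open>For \<open>s\<close> within distance 1 of \<open>t\<close>, the dilations have a common compact support and are Lipschitz in
  \<open>s\<close>, uniformly in \<open>y\<close>.\<close>

lemma dilation_locally_Lipschitz:
  assumes \<phi>: "test_function \<phi>"
  obtains C R where "C > 0" "R > 0"
    "\<And>s y. \<bar>s - t\<bar> < 1 \<Longrightarrow> \<bar>dilation b \<phi> s y\<bar> \<le> C * indicator {-R..R} y"
    "\<And>s y. \<bar>s - t\<bar> < 1 \<Longrightarrow> \<bar>b * deriv (\<lambda>x. x * dilation b \<phi> s x) y\<bar> \<le> C * indicator {-R..R} y"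
    "\<And>s y. \<bar>s - t\<bar> < 1 \<Longrightarrow> \<bar>dilation b \<phi> s y - dilation b \<phi> t y\<bar> \<le> C * indicator {-R..R} y * \<bar>s - t\<bar>"
proof -
  obtain R0 B where RB: "R0 > 0" "B > 0"
    and \<phi>0: "\<And>x. \<bar>x\<bar> > R0 \<Longrightarrow> \<phi> x = 0" "\<And>x. \<bar>\<phi> x\<bar> \<le> B"
    and D\<phi>: "\<And>x. \<bar>x\<bar> > R0 \<Longrightarrow> deriv \<phi> x = 0" "\<And>x. \<bar>deriv \<phi> x\<bar> \<le> B"
    using test_functionE[OF \<phi>] by metis
  define E where "E = exp (\<bar>b\<bar> * (\<bar>t\<bar> + 1))"
  define R where "R = R0 * E"
  \<comment> \<open>The first summand bounds the dilation, the second its \<open>s\<close>-derivative.\<close>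
  define C where "C = E * B + \<bar>b\<bar> * (E * B + R * (E\<^sup>2 * B))"
  have "E > 0" by (simp add: E_def)
  have "R > 0" using \<open>E > 0\<close> RB by (simp add: R_def)
  have "C > 0" using \<open>E > 0\<close> RB \<open>R > 0\<close> by (simp add: C_def add_pos_nonneg)
  have E: "exp (b * s) \<le> E" "exp (- (b * s)) \<le> E" if "\<bar>s - t\<bar> < 1" for s
  proof -
    have "\<bar>b * s\<bar> \<le> \<bar>b\<bar> * (\<bar>t\<bar> + 1)"
      unfolding abs_mult using that by (intro mult_left_mono) auto
    then show "exp (b * s) \<le> E" "exp (- (b * s)) \<le> E"
      by (auto simp: E_def)
  qed
  have out: "\<bar>exp (b * s) * y\<bar> > R0" if "\<bar>s - t\<bar> < 1" "\<bar>y\<bar> > R" for s y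
  proof -
    have "R0 * exp (- (b * s)) \<le> R"
      using E(2)[OF that(1)] RB by (simp add: R_def)
    also have "\<dots> < \<bar>y\<bar>" by fact
    finally show ?thesis
      by (simp add: exp_minus abs_mult field_simps)
  qed
  have D: "b * deriv (\<lambda>x. x * dilation b \<phi> s x) y
            = b * (dilation b \<phi> s y + y * ((exp (b * s))\<^sup>2 * deriv \<phi> (exp (b * s) * y)))" for s y
    by (simp only: DERIV_imp_deriv[OF has_derivative_id_times_dilation[OF \<phi>]])
  have b0: "\<bar>dilation b \<phi> s y\<bar> \<le> E * B" if "\<bar>s - t\<bar> < 1" for s y
    unfolding dilation_def abs_mult using E[OF that] \<phi>0 \<open>E > 0\<close> by (intro mult_mono) auto
  have b1: "\<bar>dilation b \<phi> s y\<bar> \<le> C * indicator {-R..R} y" if "\<bar>s - t\<bar> < 1" for s y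
  proof (cases "y \<in> {-R..R}")
    case True
    have "E * B \<le> C"
      using \<open>E > 0\<close> RB \<open>R > 0\<close> by (simp add: C_def)
    with True b0[OF that, of y] show ?thesis by simp
  next
    case False
    then have "dilation b \<phi> s y = 0"
      using out[OF that, of y] \<phi>0(1) by (auto simp: dilation_def)
    then show ?thesis using False by simp
  qed
  have b2: "\<bar>b * deriv (\<lambda>x. x * dilation b \<phi> s x) y\<bar> \<le> C * indicator {-R..R} y" if "\<bar>s - t\<bar> < 1" for s y
  proof (cases "y \<in> {-R..R}")
    case True
    have "\<bar>y * ((exp (b * s))\<^sup>2 * deriv \<phi> (exp (b * s) * y))\<bar> \<le> R * (E\<^sup>2 * B)"
      unfolding abs_mult using True E[OF that] D\<phi> \<open>E > 0\<close> \<open>R > 0\<close> RB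
      by (intro mult_mono) (auto intro: power_mono)
    with b0[OF that, of y] have "\<bar>dilation b \<phi> s y + y * ((exp (b * s))\<^sup>2 * deriv \<phi> (exp (b * s) * y))\<bar>
        \<le> E * B + R * (E\<^sup>2 * B)"
      by linarith
    then have "\<bar>b * deriv (\<lambda>x. x * dilation b \<phi> s x) y\<bar> \<le> \<bar>b\<bar> * (E * B + R * (E\<^sup>2 * B))"
      unfolding D abs_mult by (intro mult_left_mono) auto
    also have "\<dots> \<le> C"
      using \<open>E > 0\<close> RB by (simp add: C_def)
    finally show ?thesis using True by simp
  next
    case False
    then have "dilation b \<phi> s y = 0" "deriv \<phi> (exp (b * s) * y) = 0"
      using out[OF that, of y] \<phi>0(1) D\<phi>(1) by (auto simp: dilation_def)
    then show ?thesis using False unfolding D by simp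
  qed
  have b3: "\<bar>dilation b \<phi> s y - dilation b \<phi> t y\<bar> \<le> C * indicator {-R..R} y * \<bar>s - t\<bar>" if "\<bar>s - t\<bar> < 1" for s y
  proof -
    have "norm (dilation b \<phi> s y - dilation b \<phi> t y) \<le> (C * indicator {-R..R} y) * norm (s - t)"
    proof (rule field_differentiable_bound)
      show "convex {t - 1<..<t + 1}" by simp
      show "((\<lambda>s. dilation b \<phi> s y) has_field_derivative b * deriv (\<lambda>x. x * dilation b \<phi> z x) y)
              (at z within {t - 1<..<t + 1})" for z
        by (rule has_field_derivative_at_within[OF dilation_time_derivative[OF \<phi>]])
      show "norm (b * deriv (\<lambda>x. x * dilation b \<phi> z x) y) \<le> C * indicator {-R..R} y"
        if "z \<in> {t - 1<..<t + 1}" for z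
        using b2[of z y] that by auto
    qed (use that in auto)
    then show ?thesis by simp
  qed
  show thesis
    using that[of C R] \<open>C > 0\<close> \<open>R > 0\<close> b1 b2 b3 by blast
qed

lemma integrable_times_test_function:
  assumes "locally_integrable w" "test_function \<phi>"
  shows "integrable lebesgue (\<lambda>x. w x * complex_of_real (\<phi> x))"
proof -
  obtain R B where "\<And>x. \<bar>x\<bar> > R \<Longrightarrow> \<phi> x = 0" "\<And>x. \<bar>\<phi> x\<bar> \<le> B"
    using test_functionE[OF assms(2)] by metis
  then have "\<bar>\<phi> x\<bar> \<le> B * indicator {-R..R} x" for x
    by (cases "\<bar>x\<bar> > R") (auto simp: indicator_def)
  then show ?thesis
    by (rule integrable_times_bounded_support[OF assms(1) test_function_measurable[OF assms(2)]])
qed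

lemma distr_of_dilation_has_derivative:
  assumes w: "locally_integrable w" and \<phi>: "test_function \<phi>"
  shows "((\<lambda>s. distr_of w (dilation b \<phi> s)) has_vector_derivative
            b *\<^sub>R distr_of w (deriv (\<lambda>x. x * dilation b \<phi> t x))) (at t)"
proof -
  define \<kappa> where "\<kappa> = dilation b \<phi>"
  define \<kappa>' where "\<kappa>' y = b * deriv (\<lambda>x. x * \<kappa> t x) y" for y
  define S where "S = {t - 1<..<t + 1}"
  have S: "at t within S = at t"
    unfolding S_def by (rule at_within_open) auto
  obtain C R where "C > 0" and
    K: "\<And>s y. s \<in> S \<Longrightarrow> \<bar>\<kappa> s y\<bar> \<le> C * indicator {-R..R} y"
      "\<And>y. \<bar>\<kappa>' y\<bar> \<le> C * indicator {-R..R} y"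
      "\<And>s y. s \<in> S \<Longrightarrow> \<bar>\<kappa> s y - \<kappa> t y\<bar> \<le> C * indicator {-R..R} y * \<bar>s - t\<bar>"
  proof -
    have S1: "\<bar>s - t\<bar> < 1" if "s \<in> S" for s
      using that by (auto simp: S_def)
    obtain C R where "C > 0" and
      C: "\<And>s y. \<bar>s - t\<bar> < 1 \<Longrightarrow> \<bar>dilation b \<phi> s y\<bar> \<le> C * indicator {-R..R} y"
      "\<And>s y. \<bar>s - t\<bar> < 1 \<Longrightarrow> \<bar>b * deriv (\<lambda>x. x * dilation b \<phi> s x) y\<bar> \<le> C * indicator {-R..R} y"
      "\<And>s y. \<bar>s - t\<bar> < 1 \<Longrightarrow> \<bar>dilation b \<phi> s y - dilation b \<phi> t y\<bar> \<le> C * indicator {-R..R} y * \<bar>s - t\<bar>"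
      by (rule dilation_locally_Lipschitz[OF \<phi>, of t b]) blast
    show thesis
      by (rule that[of C R]) (use \<open>C > 0\<close> C S1 in \<open>auto simp: \<kappa>_def \<kappa>'_def\<close>)
  qed
  have int: "integrable lebesgue (\<lambda>y. w y * complex_of_real (\<kappa> s y))" for s
    unfolding \<kappa>_def by (intro integrable_times_test_function w test_function_dilation \<phi>)
  have test': "test_function (deriv (\<lambda>x. x * \<kappa> t x))"
    unfolding \<kappa>_def by (intro test_function_euler test_function_dilation \<phi>)
  have int': "integrable lebesgue (\<lambda>y. w y * complex_of_real (\<kappa>' y))"
    using integrable_mult_right[OF integrable_times_test_function[OF w test'], of "complex_of_real b"]
    by (simp add: \<kappa>'_def mult_ac)
  have D: "b *\<^sub>R distr_of w (deriv (\<lambda>x. x * dilation b \<phi> t x)) = (LINT y|lebesgue. w y * complex_of_real (\<kappa>' y))"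
  proof -
    have "(LINT y|lebesgue. w y * complex_of_real (\<kappa>' y))
        = (LINT y|lebesgue. complex_of_real b * (w y * complex_of_real (deriv (\<lambda>x. x * \<kappa> t x) y)))"
      by (simp add: \<kappa>'_def mult_ac)
    then show ?thesis
      by (simp add: distr_of_def \<kappa>_def scaleR_conv_of_real)
  qed
  \<comment> \<open>The error of the first-order expansion at \<open>t\<close>, divided by the distance; its integral tends to 0.\<close>
  define q where "q s y = w y * complex_of_real ((\<kappa> s y - \<kappa> t y - (s - t) * \<kappa>' y) / \<bar>s - t\<bar>)" for s y
  have q_eq: "q s y = (w y * complex_of_real (\<kappa> s y) - w y * complex_of_real (\<kappa> t y)
       - (s - t) *\<^sub>R (w y * complex_of_real (\<kappa>' y))) /\<^sub>R norm (s - t)" for s y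
    by (simp add: q_def scaleR_conv_of_real field_simps)
  have int_q: "integrable lebesgue (q s)" for s
    unfolding q_eq[abs_def] using int int' by simp
  have "((\<lambda>s. LINT y|lebesgue. q s y) \<longlongrightarrow> integral\<^sup>L lebesgue (\<lambda>_::real. 0)) (at t within S)"
  proof (rule dominated_convergence_within)
    show "q s \<in> borel_measurable lebesgue" for s
      using int_q by (rule borel_measurable_integrable)
    show "integrable lebesgue (\<lambda>y. 2 * C * norm (indicator {-R..R} y *\<^sub>R w y))"
      using w unfolding locally_integrable_def set_integrable_def by (intro integrable_mult_right integrable_norm) auto
    show "norm (q s y) \<le> 2 * C * norm (indicator {-R..R} y *\<^sub>R w y)" if "s \<in> S - {t}" for s y
    proof -
      have "\<bar>\<kappa> s y - \<kappa> t y - (s - t) * \<kappa>' y\<bar> \<le> \<bar>\<kappa> s y - \<kappa> t y\<bar> + \<bar>\<kappa>' y\<bar> * \<bar>s - t\<bar>"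
        by (metis abs_mult abs_triangle_ineq4 mult.commute)
      also have "\<dots> \<le> C * indicator {-R..R} y * \<bar>s - t\<bar> + C * indicator {-R..R} y * \<bar>s - t\<bar>"
        using K(3)[of s y] K(2)[of y] that by (intro add_mono mult_right_mono) auto
      finally have "\<bar>\<kappa> s y - \<kappa> t y - (s - t) * \<kappa>' y\<bar> / \<bar>s - t\<bar> \<le> 2 * C * indicator {-R..R} y"
        using that by (simp add: field_simps)
      then have "norm (w y) * (\<bar>\<kappa> s y - \<kappa> t y - (s - t) * \<kappa>' y\<bar> / \<bar>s - t\<bar>) \<le> norm (w y) * (2 * C * indicator {-R..R} y)"
        by (rule mult_left_mono) simp
      then show ?thesis
        by (simp add: q_def norm_mult norm_divide mult_ac del: of_real_diff of_real_mult of_real_divide)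
    qed
    show "((\<lambda>s. q s y) \<longlongrightarrow> 0) (at t within S)" for y
    proof -
      have "((\<lambda>s. \<kappa> s y) has_derivative (*) (\<kappa>' y)) (at t)"
        using dilation_time_derivative[OF \<phi>, of b y t]
        unfolding has_field_derivative_def \<kappa>_def \<kappa>'_def .
      then have "((\<lambda>s. (\<kappa> s y - \<kappa> t y - (s - t) * \<kappa>' y) / \<bar>s - t\<bar>) \<longlongrightarrow> 0) (at t)"
        by (simp add: has_derivative_at_within divide_inverse mult_ac)
      then have "((\<lambda>s. w y * complex_of_real ((\<kappa> s y - \<kappa> t y - (s - t) * \<kappa>' y) / \<bar>s - t\<bar>)) \<longlongrightarrow> w y * complex_of_real 0) (at t)"
        by (intro tendsto_intros)
      then show ?thesis
        by (simp add: S q_def)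
    qed
  qed simp
  moreover have "(LINT y|lebesgue. q s y) =
      ((distr_of w (\<kappa> s) - distr_of w (\<kappa> t)) - (s - t) *\<^sub>R (LINT y|lebesgue. w y * complex_of_real (\<kappa>' y))) /\<^sub>R norm (s - t)" for s
    unfolding q_eq distr_of_def using int int' by simp
  ultimately show ?thesis
    unfolding has_vector_derivative_def has_derivative_at_within D
    by (simp add: S \<kappa>_def bounded_linear_scaleR_left)
qed

section \<open>Square-integrable functions and their dilations\<close>

lemma in_L2_measurable: "in_L2 f \<Longrightarrow> f \<in> borel_measurable lebesgue"
  by (simp add: in_L2_def)

lemma in_L2_integrable: "in_L2 f \<Longrightarrow> integrable lebesgue (\<lambda>x. (cmod (f x))\<^sup>2)"
  by (simp add: in_L2_def)

lemma norm_diff_sq_le: "(norm (x - y))\<^sup>2 \<le> 2 * (norm x)\<^sup>2 + 2 * (norm y)\<^sup>2"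
  for x y :: "'a::real_normed_vector"
proof -
  have "(norm (x - y))\<^sup>2 \<le> (norm x + norm y)\<^sup>2"
    by (intro power_mono norm_triangle_ineq4) simp
  also have "\<dots> \<le> 2 * (norm x)\<^sup>2 + 2 * (norm y)\<^sup>2"
    using zero_le_power2[of "norm x - norm y"] by (simp add: power2_eq_square algebra_simps)
  finally show ?thesis .
qed

lemma in_L2_diff:
  assumes "in_L2 f" "in_L2 g"
  shows "in_L2 (\<lambda>x. f x - g x)"
proof -
  have m: "(\<lambda>x. f x - g x) \<in> borel_measurable lebesgue"
    by (intro borel_measurable_diff in_L2_measurable assms)
  have "integrable lebesgue (\<lambda>x. (cmod (f x - g x))\<^sup>2)"
  proof (rule Bochner_Integration.integrable_bound)
    show "integrable lebesgue (\<lambda>x. 2 * (cmod (f x))\<^sup>2 + 2 * (cmod (g x))\<^sup>2)"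
      using assms by (simp add: in_L2_def)
    show "AE x in lebesgue. norm ((cmod (f x - g x))\<^sup>2) \<le> norm (2 * (cmod (f x))\<^sup>2 + 2 * (cmod (g x))\<^sup>2)"
      using norm_diff_sq_le by (intro AE_I2) (auto simp: abs_of_nonneg)
  qed (use m in simp)
  with m show ?thesis
    by (simp add: in_L2_def)
qed

lemma L2_norm_nonneg: "L2_norm f \<ge> 0"
  by (simp add: L2_norm_def)

lemma L2_norm_sq: "(L2_norm f)\<^sup>2 = (LINT x|lebesgue. (cmod (f x))\<^sup>2)"
  by (simp add: L2_norm_def)

lemma
  assumes "in_L2 f" and "c > 0"
  shows in_L2_scale: "in_L2 (\<lambda>x. f (c * x))"
    and integral_sq_scale: "(LINT x|lebesgue. (cmod (f (c * x)))\<^sup>2) = (LINT x|lebesgue. (cmod (f x))\<^sup>2) / c"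
proof -
  have "(\<lambda>x. c * x) \<in> lebesgue \<rightarrow>\<^sub>M lebesgue"
    using lebesgue_measurable_scaling[where 'a = real, of c] by (simp add: real_scaleR_def[abs_def])
  from measurable_compose[OF this in_L2_measurable[OF assms(1)]]
  show "in_L2 (\<lambda>x. f (c * x))"
    using lebesgue_integrable_real_affine[OF in_L2_integrable[OF assms(1)], of c 0] assms(2)
    by (simp add: in_L2_def)
  show "(LINT x|lebesgue. (cmod (f (c * x)))\<^sup>2) = (LINT x|lebesgue. (cmod (f x))\<^sup>2) / c"
    using lebesgue_integral_real_affine[of c "\<lambda>x. (cmod (f x))\<^sup>2" 0] assms(2) by simp
qed

lemma integrable_indicator_interval: "integrable lebesgue (indicator {c..d} :: real \<Rightarrow> real)"
  by (simp add: integrable_indicator_iff emeasure_lborel_Icc_eq)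

lemma in_L2_locally_integrable:
  assumes "in_L2 f"
  shows "locally_integrable f"
  unfolding locally_integrable_def set_integrable_def
proof
  fix R :: real
  show "integrable lebesgue (\<lambda>x. indicator {-R..R} x *\<^sub>R f x)"
  proof (rule Bochner_Integration.integrable_bound)
    show "integrable lebesgue (\<lambda>x. indicator {-R..R} x + (cmod (f x))\<^sup>2)"
      by (intro Bochner_Integration.integrable_add integrable_indicator_interval in_L2_integrable assms)
    have "cmod (f x) \<le> 1 + (cmod (f x))\<^sup>2" for x
      using zero_le_power2[of "cmod (f x) - 1"] zero_le_power2[of "cmod (f x)"]
        norm_ge_zero[of "f x"]
      unfolding power2_diff by (simp del: zero_le_power2 norm_ge_zero)
    then show "AE x in lebesgue. norm (indicator {-R..R} x *\<^sub>R f x) \<le> norm (indicator {-R..R} x + (cmod (f x))\<^sup>2)"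
      by (intro AE_I2) (auto simp: indicator_def abs_of_nonneg)
    show "(\<lambda>x. indicator {-R..R} x *\<^sub>R f x) \<in> borel_measurable lebesgue"
      by (intro borel_measurable_scaleR in_L2_measurable assms measurable_completion) simp
  qed
qed

text \<open>A form of the Cauchy--Schwarz inequality; the constant \<open>1/2 + R\<close> is not optimal, but it comes
  directly from \<open>2 |w| \<le> |w|\<^sup>2/N + N\<close> with \<open>N\<close> the norm of \<open>w\<close>.\<close>

lemma L2_pairing_bound:
  assumes w: "in_L2 w" and g: "g \<in> borel_measurable lebesgue"
    and bound: "\<And>y. \<bar>g y\<bar> \<le> C * indicator {-R..R} y" and "C \<ge> 0" "R \<ge> 0"
  shows "norm (distr_of w g) \<le> C * (1 / 2 + R) * L2_norm w"
proof (cases "L2_norm w = 0")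
  case True
  then have "(LINT x|lebesgue. (cmod (w x))\<^sup>2) = 0"
    using L2_norm_sq[of w] by simp
  then have "AE x in lebesgue. (cmod (w x))\<^sup>2 = 0"
    using integral_nonneg_eq_0_iff_AE[OF in_L2_integrable[OF w]] by simp
  then have "distr_of w g = 0"
    unfolding distr_of_def by (intro integral_eq_zero_AE) auto
  with True show ?thesis by simp
next
  case False
  define N where "N = L2_norm w"
  have "N > 0"
    using False L2_norm_nonneg[of w] by (simp add: N_def)
  have int: "integrable lebesgue (\<lambda>y. w y * complex_of_real (g y))"
    by (rule integrable_times_bounded_support[OF in_L2_locally_integrable[OF w] g bound])
  have "norm (distr_of w g) \<le> (LINT y|lebesgue. norm (w y * complex_of_real (g y)))"
    unfolding distr_of_def by (rule integral_norm_bound)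
  also have "\<dots> \<le> (LINT y|lebesgue. C / (2 * N) * (cmod (w y))\<^sup>2 + C * N / 2 * indicator {-R..R} y)"
  proof (rule integral_mono)
    show "integrable lebesgue (\<lambda>y. norm (w y * complex_of_real (g y)))"
      using int by (rule integrable_norm)
    show "integrable lebesgue (\<lambda>y. C / (2 * N) * (cmod (w y))\<^sup>2 + C * N / 2 * indicator {-R..R} y)"
      by (intro Bochner_Integration.integrable_add integrable_mult_right integrable_indicator_interval in_L2_integrable w)
    show "norm (w y * complex_of_real (g y)) \<le> C / (2 * N) * (cmod (w y))\<^sup>2 + C * N / 2 * indicator {-R..R} y" for y
    proof -
      have "cmod (w y) \<le> (cmod (w y))\<^sup>2 / (2 * N) + N / 2"
        using zero_le_power2[of "cmod (w y) - N"] \<open>N > 0\<close> by (simp add: field_simps power2_eq_square)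
      then have "cmod (w y) * (C * indicator {-R..R} y) \<le> ((cmod (w y))\<^sup>2 / (2 * N) + N / 2) * (C * indicator {-R..R} y)"
        using \<open>C \<ge> 0\<close> by (intro mult_right_mono) auto
      also have "\<dots> \<le> C / (2 * N) * (cmod (w y))\<^sup>2 + C * N / 2 * indicator {-R..R} y"
        using \<open>C \<ge> 0\<close> \<open>N > 0\<close> by (auto simp: indicator_def field_simps)
      finally have *: "cmod (w y) * (C * indicator {-R..R} y) \<le> C / (2 * N) * (cmod (w y))\<^sup>2 + C * N / 2 * indicator {-R..R} y" .
      have "norm (w y * complex_of_real (g y)) \<le> cmod (w y) * (C * indicator {-R..R} y)"
        using mult_left_mono[OF bound[of y], of "cmod (w y)"] by (simp add: norm_mult)
      with * show ?thesis by linarith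
    qed
  qed
  also have "\<dots> = C / (2 * N) * N\<^sup>2 + C * N / 2 * (2 * R)"
    using in_L2_integrable[OF w] integrable_indicator_interval[of "-R" R] \<open>R \<ge> 0\<close>
    by (simp add: N_def L2_norm_sq)
  also have "\<dots> = C * (1 / 2 + R) * N"
    using \<open>N > 0\<close> by (simp add: field_simps power2_eq_square)
  finally show ?thesis
    by (simp add: N_def)
qed

text \<open>Bounded functions of bounded support are dense in \<open>L\<^sup>2\<close>: cut off where \<open>|x|\<close> or \<open>|f x|\<close> exceeds \<open>n\<close>.\<close>

lemma L2_approx_truncation:
  assumes f: "in_L2 f" and "e > 0"
  obtains n :: nat and h where "n > 0" "h \<in> borel_measurable lebesgue" "in_L2 h"
    "\<And>x. cmod (h x) \<le> real n" "\<And>x. \<bar>x\<bar> > real n \<Longrightarrow> h x = 0"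
    "(LINT x|lebesgue. (cmod (f x - h x))\<^sup>2) < e"
proof -
  define h where "h n x = indicator {x. \<bar>x\<bar> \<le> real n \<and> cmod (f x) \<le> real n} x *\<^sub>R f x" for n x
  note [measurable] = in_L2_measurable[OF f]
  have id_meas [measurable]: "(\<lambda>x::real. x) \<in> borel_measurable lebesgue"
    by (rule measurable_completion) simp
  have sets: "{x. \<bar>x\<bar> \<le> real n \<and> cmod (f x) \<le> real n} \<in> sets lebesgue" for n
  proof -
    have "{x \<in> space lebesgue. \<bar>x\<bar> \<le> real n \<and> cmod (f x) \<le> real n} \<in> sets lebesgue"
      by measurable
    then show ?thesis by simp
  qed
  have meas: "h n \<in> borel_measurable lebesgue" for n
    unfolding h_def[abs_def] using sets by (intro borel_measurable_scaleR borel_measurable_indicator) auto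
  have h_le: "cmod (h n x) \<le> cmod (f x)" "cmod (f x - h n x) \<le> cmod (f x)" for n x
    by (auto simp: h_def indicator_def)
  have L2: "in_L2 (h n)" for n
    unfolding in_L2_def
    by (intro conjI meas Bochner_Integration.integrable_bound[OF in_L2_integrable[OF f]])
       (use meas h_le in \<open>auto intro: power_mono\<close>)
  have "(\<lambda>n. LINT x|lebesgue. (cmod (f x - h n x))\<^sup>2) \<longlonglongrightarrow> integral\<^sup>L lebesgue (\<lambda>_::real. 0)"
  proof (rule integral_dominated_convergence[OF _ _ in_L2_integrable[OF f]])
    show "AE x in lebesgue. (\<lambda>n. (cmod (f x - h n x))\<^sup>2) \<longlonglongrightarrow> 0"
    proof (intro AE_I2 tendsto_eventually)
      fix x
      show "\<forall>\<^sub>F n in sequentially. (cmod (f x - h n x))\<^sup>2 = 0"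
        using eventually_ge_at_top[of "nat \<lceil>max \<bar>x\<bar> (cmod (f x))\<rceil>"]
        by eventually_elim (auto simp: h_def indicator_def nat_le_iff ceiling_le_iff)
    qed
    show "(\<lambda>x. (cmod (f x - h n x))\<^sup>2) \<in> borel_measurable lebesgue" for n
      using meas[of n] by measurable
    show "AE x in lebesgue. norm ((cmod (f x - h n x))\<^sup>2) \<le> (cmod (f x))\<^sup>2" for n
      using h_le by (auto intro!: AE_I2 power_mono)
  qed simp
  then have "\<forall>\<^sub>F n in sequentially. (LINT x|lebesgue. (cmod (f x - h n x))\<^sup>2) < e"
    by (rule order_tendstoD(2)) (use \<open>e > 0\<close> in simp)
  then have "\<forall>\<^sub>F n in sequentially. (LINT x|lebesgue. (cmod (f x - h n x))\<^sup>2) < e \<and> n > 0"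
    using eventually_gt_at_top[of 0] by eventually_elim simp
  then obtain n where n: "(LINT x|lebesgue. (cmod (f x - h n x))\<^sup>2) < e" "n > 0"
    using eventually_happens' trivial_limit_sequentially by fastforce
  show thesis
    by (rule that[of n "h n"]) (use n meas L2 in \<open>auto simp: h_def indicator_def\<close>)
qed

text \<open>Continuous functions of compact support are dense in \<open>L\<^sup>2\<close>. A truncation \<open>h\<close> of \<open>f\<close> is the almost
  everywhere limit of continuous functions; projecting their values to a ball and multiplying by a
  piecewise linear cutoff provides an integrable majorant without changing the limit.\<close>

lemma L2_approx_continuous:
  assumes f: "in_L2 f" and "e > 0"
  obtains g R B where "continuous_on UNIV g" "in_L2 g"
    "\<And>x. \<bar>x\<bar> > R \<Longrightarrow> g x = 0" "\<And>x. cmod (g x) \<le> B"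
    "(LINT x|lebesgue. (cmod (f x - g x))\<^sup>2) < e"
proof -
  obtain n :: nat and h where "n > 0" and h_meas: "h \<in> borel_measurable lebesgue" and h: "in_L2 h"
    and h_le: "\<And>x. cmod (h x) \<le> real n" and h0: "\<And>x. \<bar>x\<bar> > real n \<Longrightarrow> h x = 0"
    and fh: "(LINT x|lebesgue. (cmod (f x - h x))\<^sup>2) < e / 4"
    using L2_approx_truncation[OF f, of "e / 4"] \<open>e > 0\<close> by auto
  have "h measurable_on UNIV"
    using h_meas by (intro lebesgue_measurable_imp_measurable_on) auto
  then obtain N G where N: "negligible N" and G: "\<And>k. continuous_on UNIV (G k)"
    and lim: "\<And>x. x \<notin> N \<Longrightarrow> (\<lambda>k. G k x) \<longlonglongrightarrow> h x"
    unfolding measurable_on_def by auto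
  define P :: "complex \<Rightarrow> complex" where "P = closest_point (cball 0 (real n))"
  define \<eta> where "\<eta> x = max 0 (min 1 (real n + 1 - \<bar>x\<bar>))" for x
  define u where "u k x = \<eta> x *\<^sub>R P (G k x)" for k x
  have P_cont: "continuous_on UNIV P"
    unfolding P_def by (rule continuous_on_closest_point) auto
  have P_le: "cmod (P z) \<le> real n" for z
    using closest_point_in_set[of "cball 0 (real n)" z] by (auto simp: P_def)
  have P_id: "P z = z" if "cmod z \<le> real n" for z
    using that by (auto simp: P_def intro: closest_point_self)
  have \<eta>: "0 \<le> \<eta> x" "\<eta> x \<le> 1" for x
    by (auto simp: \<eta>_def)
  have \<eta>1: "\<eta> x = 1" if "\<bar>x\<bar> \<le> real n" for x
    using that by (auto simp: \<eta>_def)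
  have \<eta>0: "\<eta> x = 0" if "\<bar>x\<bar> > real n + 1" for x
    using that by (auto simp: \<eta>_def)
  have u_cont: "continuous_on UNIV (u k)" for k
    unfolding u_def \<eta>_def by (intro continuous_intros continuous_on_compose2[OF P_cont G]) auto
  have u_meas: "u k \<in> borel_measurable lebesgue" for k
    using u_cont[of k] by (intro measurable_completion) (simp add: borel_measurable_continuous_onI)
  have u_le: "cmod (u k x) \<le> real n" for k x
    using mult_mono[OF \<eta>(2)[of x] P_le[of "G k x"]] \<eta>(1)[of x] by (simp add: u_def)
  have u0: "u k x = 0" if "\<bar>x\<bar> > real n + 1" for k x
    using \<eta>0[OF that] by (simp add: u_def)
  have u_le': "cmod (u k x) \<le> real n * indicator {-(real n + 1)..real n + 1} x" for k x
    using u_le[of k x] u0[of x k] by (cases "\<bar>x\<bar> > real n + 1") (auto simp: indicator_def)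
  have ind: "integrable lebesgue (\<lambda>x. c * indicator {-(real n + 1)..real n + 1} x :: real)" for c
    by (intro integrable_mult_right integrable_indicator_interval)
  have u_L2: "in_L2 (u k)" for k
    unfolding in_L2_def
  proof (intro conjI u_meas Bochner_Integration.integrable_bound[OF ind])
    show "(\<lambda>x. (cmod (u k x))\<^sup>2) \<in> borel_measurable lebesgue"
      using u_meas[of k] by measurable
    show "AE x in lebesgue. norm ((cmod (u k x))\<^sup>2)
            \<le> norm ((real n)\<^sup>2 * indicator {-(real n + 1)..real n + 1} x :: real)"
    proof (intro AE_I2)
      fix x
      show "norm ((cmod (u k x))\<^sup>2) \<le> norm ((real n)\<^sup>2 * indicator {-(real n + 1)..real n + 1} x :: real)"
        using power_mono[OF u_le'[of k x], of 2] by (auto simp: indicator_def)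
    qed
  qed
  have "(\<lambda>k. LINT x|lebesgue. (cmod (h x - u k x))\<^sup>2) \<longlonglongrightarrow> integral\<^sup>L lebesgue (\<lambda>_::real. 0)"
  proof (rule integral_dominated_convergence[OF _ _ ind[of "(2 * real n)\<^sup>2"]])
    have "AE x in lebesgue. x \<notin> N"
      using N by (intro AE_not_in) (simp add: negligible_iff_null_sets)
    then show "AE x in lebesgue. (\<lambda>k. (cmod (h x - u k x))\<^sup>2) \<longlonglongrightarrow> 0"
    proof eventually_elim
      case (elim x)
      have "isCont P (h x)"
        using P_cont by (simp add: continuous_on_eq_continuous_at)
      then have "(\<lambda>k. P (G k x)) \<longlonglongrightarrow> P (h x)"
        using lim[OF elim] by (rule isCont_tendsto_compose)
      then have "(\<lambda>k. (cmod (h x - u k x))\<^sup>2) \<longlonglongrightarrow> (cmod (h x - \<eta> x *\<^sub>R P (h x)))\<^sup>2"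
        unfolding u_def by (intro tendsto_intros)
      moreover have "\<eta> x *\<^sub>R P (h x) = h x"
        using P_id[OF h_le] P_id[of 0] h0[of x] \<eta>1[of x] by (cases "\<bar>x\<bar> > real n") auto
      ultimately show ?case by simp
    qed
    show "(\<lambda>x. (cmod (h x - u k x))\<^sup>2) \<in> borel_measurable lebesgue" for k
      using u_meas[of k] h_meas by measurable
    show "AE x in lebesgue. norm ((cmod (h x - u k x))\<^sup>2)
            \<le> (2 * real n)\<^sup>2 * indicator {-(real n + 1)..real n + 1} x" for k
    proof (intro AE_I2)
      fix x
      have "cmod (h x - u k x) \<le> 2 * real n"
        using norm_triangle_ineq4[of "h x" "u k x"] h_le[of x] u_le[of k x] by linarith
      then have "(cmod (h x - u k x))\<^sup>2 \<le> (2 * real n)\<^sup>2"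
        by (intro power_mono) auto
      moreover have "h x - u k x = 0" if "\<bar>x\<bar> > real n + 1"
        using that h0[of x] u0[of x k] by simp
      ultimately show "norm ((cmod (h x - u k x))\<^sup>2)
            \<le> (2 * real n)\<^sup>2 * indicator {-(real n + 1)..real n + 1} x"
        by (cases "\<bar>x\<bar> > real n + 1") (auto simp: indicator_def)
    qed
  qed simp
  then have "\<forall>\<^sub>F k in sequentially. (LINT x|lebesgue. (cmod (h x - u k x))\<^sup>2) < e / 4"
    by (rule order_tendstoD(2)) (use \<open>e > 0\<close> in simp)
  then obtain k where k: "(LINT x|lebesgue. (cmod (h x - u k x))\<^sup>2) < e / 4"
    using eventually_happens' trivial_limit_sequentially by fastforce
  have "(LINT x|lebesgue. (cmod (f x - u k x))\<^sup>2)
      \<le> (LINT x|lebesgue. 2 * (cmod (f x - h x))\<^sup>2 + 2 * (cmod (h x - u k x))\<^sup>2)"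
  proof (rule integral_mono)
    show "(cmod (f x - u k x))\<^sup>2 \<le> 2 * (cmod (f x - h x))\<^sup>2 + 2 * (cmod (h x - u k x))\<^sup>2" for x
      using norm_diff_sq_le[of "f x - h x" "u k x - h x"] by (simp add: norm_minus_commute)
  qed (intro Bochner_Integration.integrable_add integrable_mult_right in_L2_integrable in_L2_diff f h u_L2)+
  also have "\<dots> = 2 * (LINT x|lebesgue. (cmod (f x - h x))\<^sup>2) + 2 * (LINT x|lebesgue. (cmod (h x - u k x))\<^sup>2)"
    using in_L2_integrable[OF in_L2_diff[OF f h]] in_L2_integrable[OF in_L2_diff[OF h u_L2[of k]]] by simp
  also have "\<dots> < e"
    using k fh by linarith
  finally show thesis
    using that[of "u k" "real n + 1" "real n"] u_cont u_L2 u0 u_le by blast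
qed

text \<open>Strong continuity in \<open>L\<^sup>2\<close> of \<open>s \<mapsto> f(e\<^bsup>as\<^esup> \<cdot>)\<close> on \<open>[0,\<infinity>)\<close>. The restriction to \<open>s \<ge> 0\<close> makes all factors
  \<open>e\<^bsup>as\<^esup>\<close> at least 1, so that dilation neither increases the norm nor enlarges the support.\<close>

lemma dilation_L2_continuous:
  assumes f: "in_L2 f" and "a \<ge> 0"
  shows "((\<lambda>s. L2_norm (\<lambda>x. f (exp (a * s) * x) - f (exp (a * t) * x))) \<longlongrightarrow> 0) (at t within {0..})"
proof (cases "t \<ge> 0")
  case False
  then have "at t within {0..} = bot"
    by (simp add: at_within_eq_bot_iff)
  then show ?thesis by simp
next
  case True
  define D where "D = (\<lambda>f s x. f (exp (a * s) * x) :: complex)"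
  define I where "I = (\<lambda>f. LINT x|(lebesgue :: real measure). (cmod (f x :: complex))\<^sup>2)"
  have D_L2: "in_L2 (D g s)" if "in_L2 g" for g s
    unfolding D_def by (intro in_L2_scale that) simp
  have I_D: "I (D g s) \<le> I g" if "in_L2 g" "s \<ge> 0" for g s
  proof -
    have "I g \<ge> 0"
      by (simp add: I_def)
    moreover have "exp (a * s) \<ge> 1"
      using \<open>a \<ge> 0\<close> that by simp
    ultimately have "I g / exp (a * s) \<le> I g"
      by (simp add: divide_le_eq mult_left_le mult_le_cancel_left1)
    then show ?thesis
      using integral_sq_scale[OF that(1), of "exp (a * s)"] by (simp add: I_def D_def)
  qed
  have "((\<lambda>s. I (\<lambda>x. D f s x - D f t x)) \<longlongrightarrow> 0) (at t within {0..})"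
  proof (rule tendstoI)
    fix e :: real assume "e > 0"
    obtain g R B where g: "continuous_on UNIV g" "in_L2 g"
      and g0: "\<And>x. \<bar>x\<bar> > R \<Longrightarrow> g x = 0" and g_le: "\<And>x. cmod (g x) \<le> B"
      and fg: "I (\<lambda>x. f x - g x) < e / 9"
      using L2_approx_continuous[OF f, of "e / 9"] \<open>e > 0\<close> unfolding I_def by auto
    have "((\<lambda>s. I (\<lambda>x. D g s x - D g t x)) \<longlongrightarrow> integral\<^sup>L lebesgue (\<lambda>_::real. 0)) (at t within {0..})"
      unfolding I_def
    proof (rule dominated_convergence_within)
      show "(\<lambda>x. (cmod (D g s x - D g t x))\<^sup>2) \<in> borel_measurable lebesgue" for s
        using in_L2_integrable[OF in_L2_diff[OF D_L2 D_L2]] g(2) by (intro borel_measurable_integrable) blast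
      show "integrable lebesgue (\<lambda>x. (2 * B)\<^sup>2 * indicator {-R..R} x :: real)"
        by (intro integrable_mult_right integrable_indicator_interval)
      show "norm ((cmod (D g s x - D g t x))\<^sup>2) \<le> (2 * B)\<^sup>2 * indicator {-R..R} x" if "s \<in> {0..} - {t}" for s x
      proof (cases "x \<in> {-R..R}")
        case True
        have "cmod (D g s x - D g t x) \<le> 2 * B"
          unfolding D_def using norm_triangle_ineq4 g_le by (smt (verit))
        then have "(cmod (D g s x - D g t x))\<^sup>2 \<le> (2 * B)\<^sup>2"
          by (intro power_mono) auto
        with True show ?thesis by simp
      next
        case False
        have "D g r x = 0" if "r \<ge> 0" for r
        proof -
          have "1 * \<bar>x\<bar> \<le> exp (a * r) * \<bar>x\<bar>"
            using \<open>a \<ge> 0\<close> that by (intro mult_right_mono) auto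
          then have "\<bar>exp (a * r) * x\<bar> > R"
            using False by (auto simp: abs_mult)
          then show ?thesis
            by (simp add: D_def g0)
        qed
        with False that True \<open>t \<ge> 0\<close> show ?thesis by simp
      qed
      show "((\<lambda>s. (cmod (D g s x - D g t x))\<^sup>2) \<longlongrightarrow> 0) (at t within {0..})" for x
      proof -
        have "continuous_on UNIV (\<lambda>s. g (exp (a * s) * x))"
          by (rule continuous_on_compose2[OF g(1)]) (auto intro!: continuous_intros)
        then have "isCont (\<lambda>s. g (exp (a * s) * x)) t"
          by (simp add: continuous_on_eq_continuous_at)
        then have "((\<lambda>s. D g s x) \<longlongrightarrow> D g t x) (at t within {0..})"
          unfolding D_def by (simp add: isCont_def Lim_at_imp_Lim_at_within)
        then have "((\<lambda>s. (cmod (D g s x - D g t x))\<^sup>2) \<longlongrightarrow> (cmod (D g t x - D g t x))\<^sup>2) (at t within {0..})"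
          by (intro tendsto_intros)
        then show ?thesis by simp
      qed
    qed simp
    then have "\<forall>\<^sub>F s in at t within {0..}. I (\<lambda>x. D g s x - D g t x) < e / 9"
      by (rule order_tendstoD(2)) (use \<open>e > 0\<close> in simp)
    moreover have "\<forall>\<^sub>F s in at t within {0..}. s \<ge> 0"
      by (auto simp: eventually_at_filter)
    ultimately show "\<forall>\<^sub>F s in at t within {0..}. dist (I (\<lambda>x. D f s x - D f t x)) 0 < e"
    proof eventually_elim
      case (elim s)
      have D_diff: "I (\<lambda>x. D f r x - D g r x) < e / 9" if "r \<ge> 0" for r
        using I_D[OF in_L2_diff[OF f g(2)] that] fg by (simp add: D_def)
      \<comment> \<open>Compare \<open>f\<close> with \<open>g\<close> at \<open>s\<close>, move \<open>g\<close> from \<open>s\<close> to \<open>t\<close>, and return to \<open>f\<close> at \<open>t\<close>.\<close>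
      have three: "(cmod (D f s x - D f t x))\<^sup>2 \<le> 3 * (cmod (D f s x - D g s x))\<^sup>2
           + 3 * (cmod (D g s x - D g t x))\<^sup>2 + 3 * (cmod (D f t x - D g t x))\<^sup>2" for x
      proof -
        define p q r where "p = D f s x - D g s x" and "q = D g s x - D g t x" and "r = D f t x - D g t x"
        have eq: "D f s x - D f t x = p + q - r"
          by (simp add: p_def q_def r_def)
        have "(cmod (p + q - r))\<^sup>2 \<le> (cmod p + cmod q + cmod r)\<^sup>2"
          using norm_triangle_ineq4[of "p + q" r] norm_triangle_ineq[of p q]
          by (intro power_mono) auto
        also have "\<dots> \<le> 3 * (cmod p)\<^sup>2 + 3 * (cmod q)\<^sup>2 + 3 * (cmod r)\<^sup>2"
          using zero_le_power2[of "cmod p - cmod q"] zero_le_power2[of "cmod q - cmod r"]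
            zero_le_power2[of "cmod p - cmod r"]
          unfolding power2_eq_square by (simp add: algebra_simps)
        finally show ?thesis
          unfolding eq unfolding p_def q_def r_def .
      qed
      note L2s = in_L2_integrable[OF in_L2_diff[OF D_L2[OF f, of s] D_L2[OF g(2), of s]]]
        in_L2_integrable[OF in_L2_diff[OF D_L2[OF g(2), of s] D_L2[OF g(2), of t]]]
        in_L2_integrable[OF in_L2_diff[OF D_L2[OF f, of t] D_L2[OF g(2), of t]]]
      have "I (\<lambda>x. D f s x - D f t x) \<le> (LINT x|lebesgue. 3 * (cmod (D f s x - D g s x))\<^sup>2
           + 3 * (cmod (D g s x - D g t x))\<^sup>2 + 3 * (cmod (D f t x - D g t x))\<^sup>2)"
        unfolding I_def
        by (rule integral_mono[OF in_L2_integrable[OF in_L2_diff[OF D_L2[OF f] D_L2[OF f]]] _ three])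
           (intro Bochner_Integration.integrable_add integrable_mult_right L2s)
      also have "\<dots> = 3 * I (\<lambda>x. D f s x - D g s x) + 3 * I (\<lambda>x. D g s x - D g t x) + 3 * I (\<lambda>x. D f t x - D g t x)"
        using L2s by (simp add: I_def)
      also have "\<dots> < e"
        using D_diff[OF elim(2)] D_diff[OF True] elim(1) by linarith
      finally show ?case
        by (simp add: I_def)
    qed
  qed
  then have "((\<lambda>s. sqrt (I (\<lambda>x. D f s x - D f t x))) \<longlongrightarrow> sqrt 0) (at t within {0..})"
    by (rule tendsto_real_sqrt)
  then show ?thesis
    by (simp add: L2_norm_def I_def D_def)
qed

section \<open>The heat equation of the Euler operator\<close>

text \<open>The operator \<open>\<phi> \<mapsto> (x \<phi>)'\<close>, which is the adjoint of \<open>-x \<partial>/\<partial>x\<close>, commutes with dilations.\<close>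

lemma deriv_id_times_dilation:
  assumes "test_function \<phi>"
  shows "deriv (\<lambda>x. x * dilation b \<phi> s x) = dilation b (deriv (\<lambda>x. x * \<phi> x)) s"
proof
  fix y
  have "deriv (\<lambda>x. x * \<phi> x) x = \<phi> x + x * deriv \<phi> x" for x
    by (rule DERIV_imp_deriv)
       (auto intro!: derivative_eq_intros test_function_has_derivative[OF assms])
  then show "deriv (\<lambda>x. x * dilation b \<phi> s x) y = dilation b (deriv (\<lambda>x. x * \<phi> x)) s y"
    unfolding DERIV_imp_deriv[OF has_derivative_id_times_dilation[OF assms]]
    by (simp add: dilation_def power2_eq_square distrib_left mult_ac)
qed

lemma euler_op_distr_of:
  assumes "test_function \<phi>"
  shows "euler_op a (distr_of w) \<phi> = - (a *\<^sub>R distr_of w (deriv (\<lambda>x. x * \<phi> x)))"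
proof -
  have "deriv (\<lambda>x. a * x * \<phi> x) y = a * deriv (\<lambda>x. x * \<phi> x) y" for y
  proof -
    have "((\<lambda>x. x * \<phi> x) has_real_derivative deriv (\<lambda>x. x * \<phi> x) y) (at y)"
      using DERIV_mult[OF DERIV_ident test_function_has_derivative[OF assms]]
      by (metis DERIV_imp_deriv)
    from DERIV_imp_deriv[OF DERIV_cmult[OF this, of a]] show ?thesis
      by (simp add: mult.assoc)
  qed
  then have "deriv (\<lambda>x. a * x * \<phi> x) = (\<lambda>y. a * deriv (\<lambda>x. x * \<phi> x) y)"
    by blast
  then have "euler_op a (distr_of w) \<phi>
      = - (LINT x|lebesgue. complex_of_real a * (w x * complex_of_real (deriv (\<lambda>x. x * \<phi> x) x)))"
    by (simp add: euler_op_def distr_mult_def distr_deriv_def distr_of_def mult_ac)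
  also have "\<dots> = - (a *\<^sub>R distr_of w (deriv (\<lambda>x. x * \<phi> x)))"
    by (simp add: distr_of_def scaleR_conv_of_real)
  finally show ?thesis .
qed

lemma distr_of_scale:
  "distr_of (\<lambda>x. w (exp (a * s) * x)) \<phi> = distr_of w (dilation (- a) \<phi> s)"
proof -
  define c where "c = exp (a * s)"
  have "c > 0" and c': "exp (- (a * s)) = inverse c"
    by (simp_all add: c_def exp_minus)
  have "distr_of w (dilation (- a) \<phi> s)
      = (LINT x|lebesgue. complex_of_real (inverse c) * (w x * complex_of_real (\<phi> (inverse c * x))))"
    by (simp add: distr_of_def dilation_def c' mult_ac)
  also have "\<dots> = \<bar>c\<bar> *\<^sub>R (LINT x|lebesgue. complex_of_real (inverse c)
      * (w (0 + c * x) * complex_of_real (\<phi> (inverse c * (0 + c * x)))))"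
    using \<open>c > 0\<close> by (intro lebesgue_integral_real_affine) simp
  also have "\<dots> = (LINT x|lebesgue. w (c * x) * complex_of_real (\<phi> x))"
  proof -
    have cancel: "inverse c * (0 + c * x) = x" for x
      using \<open>c > 0\<close> by simp
    show ?thesis
      unfolding cancel using \<open>c > 0\<close> by (simp add: scaleR_conv_of_real field_simps)
  qed
  finally show ?thesis
    by (simp add: distr_of_def c_def)
qed

lemma distr_of_diff_left:
  assumes "locally_integrable v" "locally_integrable w" "test_function \<phi>"
  shows "distr_of (\<lambda>x. v x - w x) \<phi> = distr_of v \<phi> - distr_of w \<phi>"
  using integrable_times_test_function[OF assms(1,3)] integrable_times_test_function[OF assms(2,3)]
  by (simp add: distr_of_def left_diff_distrib)

lemma distr_of_diff_right:
  assumes "locally_integrable w" "test_function \<phi>" "test_function \<psi>"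
  shows "distr_of w (\<lambda>x. \<phi> x - \<psi> x) = distr_of w \<phi> - distr_of w \<psi>"
  using integrable_times_test_function[OF assms(1,2)] integrable_times_test_function[OF assms(1,3)]
  by (simp add: distr_of_def right_diff_distrib)

lemma dilation_is_heat_solution:
  assumes "a > 0" and v0: "in_L2 v0"
  shows "heat_cauchy_solution a v0 (\<lambda>t x. v0 (exp (a * t) * x))"
  unfolding heat_cauchy_solution_def
proof (intro conjI allI impI)
  show "in_L2 (\<lambda>x. v0 (exp (a * t) * x))" for t
    using v0 by (rule in_L2_scale) simp
  show "((\<lambda>s. L2_norm (\<lambda>x. v0 (exp (a * s) * x) - v0 (exp (a * t) * x))) \<longlongrightarrow> 0) (at t within {0..})" for t
    using v0 \<open>a > 0\<close> by (intro dilation_L2_continuous) auto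
  show "AE x in lebesgue. v0 (exp (a * 0) * x) = v0 x"
    by simp
  fix t :: real and \<phi> assume \<phi>: "test_function \<phi>"
  have "euler_op a (distr_of (\<lambda>x. v0 (exp (a * t) * x))) \<phi>
      = (- a) *\<^sub>R distr_of v0 (deriv (\<lambda>x. x * dilation (- a) \<phi> t x))"
    by (simp add: euler_op_distr_of[OF \<phi>] distr_of_scale deriv_id_times_dilation[OF \<phi>])
  then show "((\<lambda>s. distr_of (\<lambda>x. v0 (exp (a * s) * x)) \<phi>) has_vector_derivative
      euler_op a (distr_of (\<lambda>x. v0 (exp (a * t) * x))) \<phi>) (at t)"
    using distr_of_dilation_has_derivative[OF in_L2_locally_integrable[OF v0] \<phi>, of "- a" t]
    by (simp only: distr_of_scale)
qed

lemma heat_solution_L2: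
  assumes "heat_cauchy_solution a v0 v" "t \<ge> 0"
  shows "in_L2 (v t)"
  using assms by (simp add: heat_cauchy_solution_def)

text \<open>In the next five lemmas \<open>F(s) = \<integral> v(s) \<phi>\<^sub>s\<close>, where \<open>\<phi>\<^sub>s\<close> is the dilation of \<open>\<phi>\<close> with rate \<open>a\<close>. The first
  bound controls the change of \<open>v\<close> alone, the second the mixed term of the product rule for \<open>F\<close>.\<close>

lemma heat_solution_pairing_remainder:
  assumes v: "heat_cauchy_solution a v0 v" and \<phi>: "test_function \<phi>" and "t \<ge> 0"
  obtains K where
    "\<And>s. s \<ge> 0 \<Longrightarrow> norm (distr_of (\<lambda>x. v s x - v t x) (dilation a \<phi> t)) \<le> K * L2_norm (\<lambda>x. v s x - v t x)"
    "\<And>s. s \<ge> 0 \<Longrightarrow> \<bar>s - t\<bar> < 1 \<Longrightarrow> norm (distr_of (\<lambda>x. v s x - v t x) (\<lambda>x. dilation a \<phi> s x - dilation a \<phi> t x))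
        \<le> K * \<bar>s - t\<bar> * L2_norm (\<lambda>x. v s x - v t x)"
proof -
  obtain C R where "C > 0" "R > 0" and
    C: "\<And>s y. \<bar>s - t\<bar> < 1 \<Longrightarrow> \<bar>dilation a \<phi> s y\<bar> \<le> C * indicator {-R..R} y"
    "\<And>s y. \<bar>s - t\<bar> < 1 \<Longrightarrow> \<bar>dilation a \<phi> s y - dilation a \<phi> t y\<bar> \<le> C * indicator {-R..R} y * \<bar>s - t\<bar>"
    by (rule dilation_locally_Lipschitz[OF \<phi>, of t a]) blast
  have L2: "in_L2 (\<lambda>x. v s x - v t x)" if "s \<ge> 0" for s
    by (intro in_L2_diff heat_solution_L2[OF v] that \<open>t \<ge> 0\<close>)
  have meas: "dilation a \<phi> s \<in> borel_measurable lebesgue" for s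
    by (intro test_function_measurable test_function_dilation \<phi>)
  show thesis
  proof (rule that[of "C * (1 / 2 + R)"])
    show "norm (distr_of (\<lambda>x. v s x - v t x) (dilation a \<phi> t)) \<le> C * (1 / 2 + R) * L2_norm (\<lambda>x. v s x - v t x)"
      if "s \<ge> 0" for s
      by (rule L2_pairing_bound[OF L2[OF that] meas]) (use C(1)[of t] \<open>C > 0\<close> \<open>R > 0\<close> in auto)
    show "norm (distr_of (\<lambda>x. v s x - v t x) (\<lambda>x. dilation a \<phi> s x - dilation a \<phi> t x))
        \<le> C * (1 / 2 + R) * \<bar>s - t\<bar> * L2_norm (\<lambda>x. v s x - v t x)" if "s \<ge> 0" "\<bar>s - t\<bar> < 1" for s
    proof -
      have "norm (distr_of (\<lambda>x. v s x - v t x) (\<lambda>x. dilation a \<phi> s x - dilation a \<phi> t x))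
        \<le> (C * \<bar>s - t\<bar>) * (1 / 2 + R) * L2_norm (\<lambda>x. v s x - v t x)"
      proof (rule L2_pairing_bound[OF L2[OF that(1)]])
        show "(\<lambda>x. dilation a \<phi> s x - dilation a \<phi> t x) \<in> borel_measurable lebesgue"
          by (intro borel_measurable_diff meas)
        show "\<bar>dilation a \<phi> s y - dilation a \<phi> t y\<bar> \<le> C * \<bar>s - t\<bar> * indicator {-R..R} y" for y
          using C(2)[OF that(2), of y] by (simp add: mult_ac)
      qed (use \<open>C > 0\<close> \<open>R > 0\<close> in auto)
      then show ?thesis
        by (simp add: mult_ac)
    qed
  qed
qed

lemma heat_solution_pairing_eq:
  assumes v: "heat_cauchy_solution a v0 v" and \<phi>: "test_function \<phi>" and "s \<ge> 0" "t \<ge> 0"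
  shows "distr_of (v s) (dilation a \<phi> s) =
    (distr_of (v s) (dilation a \<phi> t) + (distr_of (v t) (dilation a \<phi> s) - distr_of (v t) (dilation a \<phi> t)))
     + distr_of (\<lambda>x. v s x - v t x) (\<lambda>x. dilation a \<phi> s x - dilation a \<phi> t x)"
proof -
  have loc: "locally_integrable (v s)" "locally_integrable (v t)" "locally_integrable (\<lambda>x. v s x - v t x)"
    by (intro in_L2_locally_integrable in_L2_diff heat_solution_L2[OF v] assms)+
  note test = test_function_dilation[OF \<phi>, of a]
  show ?thesis
    by (simp add: distr_of_diff_right[OF loc(3) test test] distr_of_diff_left[OF loc(1,2) test])
qed

lemma heat_solution_pairing_continuous:
  assumes v: "heat_cauchy_solution a v0 v" and \<phi>: "test_function \<phi>" and "t \<ge> 0"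
  shows "((\<lambda>s. distr_of (v s) (dilation a \<phi> s)) \<longlongrightarrow> distr_of (v t) (dilation a \<phi> t)) (at t within {0..})"
proof -
  obtain K where
    K: "\<And>s. s \<ge> 0 \<Longrightarrow> norm (distr_of (\<lambda>x. v s x - v t x) (dilation a \<phi> t)) \<le> K * L2_norm (\<lambda>x. v s x - v t x)"
    "\<And>s. s \<ge> 0 \<Longrightarrow> \<bar>s - t\<bar> < 1 \<Longrightarrow> norm (distr_of (\<lambda>x. v s x - v t x) (\<lambda>x. dilation a \<phi> s x - dilation a \<phi> t x))
        \<le> K * \<bar>s - t\<bar> * L2_norm (\<lambda>x. v s x - v t x)"
    by (rule heat_solution_pairing_remainder[OF v \<phi> \<open>t \<ge> 0\<close>]) blast
  have L2_cont: "((\<lambda>s. L2_norm (\<lambda>x. v s x - v t x)) \<longlongrightarrow> 0) (at t within {0..})"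
    using v \<open>t \<ge> 0\<close> by (simp add: heat_cauchy_solution_def)
  have loc: "locally_integrable (v s)" if "s \<ge> 0" for s
    by (intro in_L2_locally_integrable heat_solution_L2[OF v] that)
  note test = test_function_dilation[OF \<phi>, of a]
  have nonneg: "\<forall>\<^sub>F s in at t within {0..}. s \<ge> 0"
    by (auto simp: eventually_at_filter)
  have near: "\<forall>\<^sub>F s in at t within {0..}. \<bar>s - t\<bar> < 1"
    by (auto simp: eventually_at dist_real_def intro!: exI[of _ 1])
  have "((\<lambda>s. distr_of (\<lambda>x. v s x - v t x) (dilation a \<phi> t)) \<longlongrightarrow> 0) (at t within {0..})"
  proof (rule Lim_null_comparison)
    show "\<forall>\<^sub>F s in at t within {0..}. norm (distr_of (\<lambda>x. v s x - v t x) (dilation a \<phi> t)) \<le> K * L2_norm (\<lambda>x. v s x - v t x)"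
      using nonneg by eventually_elim (rule K(1))
  qed (use tendsto_mult_left[OF L2_cont, of K] in simp)
  then have "((\<lambda>s. distr_of (\<lambda>x. v s x - v t x) (dilation a \<phi> t) + distr_of (v t) (dilation a \<phi> t))
      \<longlongrightarrow> 0 + distr_of (v t) (dilation a \<phi> t)) (at t within {0..})"
    by (intro tendsto_intros)
  moreover have "\<forall>\<^sub>F s in at t within {0..}. distr_of (\<lambda>x. v s x - v t x) (dilation a \<phi> t) + distr_of (v t) (dilation a \<phi> t)
      = distr_of (v s) (dilation a \<phi> t)"
    using nonneg by eventually_elim (simp add: distr_of_diff_left[OF loc loc[OF \<open>t \<ge> 0\<close>] test])
  ultimately have A: "((\<lambda>s. distr_of (v s) (dilation a \<phi> t)) \<longlongrightarrow> distr_of (v t) (dilation a \<phi> t)) (at t within {0..})"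
    using Lim_transform_eventually by fastforce
  have "isCont (\<lambda>s. distr_of (v t) (dilation a \<phi> s)) t"
    using distr_of_dilation_has_derivative[OF loc[OF \<open>t \<ge> 0\<close>] \<phi>] by (rule has_vector_derivative_continuous)
  then have B: "((\<lambda>s. distr_of (v t) (dilation a \<phi> s)) \<longlongrightarrow> distr_of (v t) (dilation a \<phi> t)) (at t within {0..})"
    by (simp add: isCont_def Lim_at_imp_Lim_at_within)
  have C: "((\<lambda>s. distr_of (\<lambda>x. v s x - v t x) (\<lambda>x. dilation a \<phi> s x - dilation a \<phi> t x)) \<longlongrightarrow> 0) (at t within {0..})"
  proof (rule Lim_null_comparison)
    show "\<forall>\<^sub>F s in at t within {0..}. norm (distr_of (\<lambda>x. v s x - v t x) (\<lambda>x. dilation a \<phi> s x - dilation a \<phi> t x))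
        \<le> K * \<bar>s - t\<bar> * L2_norm (\<lambda>x. v s x - v t x)"
      using nonneg near by eventually_elim (rule K(2))
    have "((\<lambda>s. K * \<bar>s - t\<bar> * L2_norm (\<lambda>x. v s x - v t x)) \<longlongrightarrow> K * \<bar>t - t\<bar> * 0) (at t within {0..})"
      by (intro tendsto_intros L2_cont)
    then show "((\<lambda>s. K * \<bar>s - t\<bar> * L2_norm (\<lambda>x. v s x - v t x)) \<longlongrightarrow> 0) (at t within {0..})"
      by simp
  qed
  have "((\<lambda>s. (distr_of (v s) (dilation a \<phi> t) + (distr_of (v t) (dilation a \<phi> s) - distr_of (v t) (dilation a \<phi> t)))
     + distr_of (\<lambda>x. v s x - v t x) (\<lambda>x. dilation a \<phi> s x - dilation a \<phi> t x))
     \<longlongrightarrow> (distr_of (v t) (dilation a \<phi> t) + (distr_of (v t) (dilation a \<phi> t) - distr_of (v t) (dilation a \<phi> t))) + 0) (at t within {0..})"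
    by (intro tendsto_add tendsto_diff tendsto_const A B C)
  moreover have "\<forall>\<^sub>F s in at t within {0..}.
     (distr_of (v s) (dilation a \<phi> t) + (distr_of (v t) (dilation a \<phi> s) - distr_of (v t) (dilation a \<phi> t)))
     + distr_of (\<lambda>x. v s x - v t x) (\<lambda>x. dilation a \<phi> s x - dilation a \<phi> t x) = distr_of (v s) (dilation a \<phi> s)"
    using nonneg by eventually_elim (simp only: heat_solution_pairing_eq[OF v \<phi> _ \<open>t \<ge> 0\<close>])
  ultimately show ?thesis
    using Lim_transform_eventually by fastforce
qed

text \<open>The equation for \<open>v\<close> contributes \<open>-a \<integral> v(t) (x \<phi>\<^sub>t)'\<close> to the derivative of \<open>F\<close>, and the transport equation
  for \<open>\<phi>\<^sub>s\<close> contributes the opposite; the mixed term \<open>r\<close> has derivative 0.\<close>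

lemma heat_solution_pairing_derivative:
  assumes v: "heat_cauchy_solution a v0 v" and \<phi>: "test_function \<phi>" and "t > 0"
  shows "((\<lambda>s. distr_of (v s) (dilation a \<phi> s)) has_vector_derivative 0) (at t)"
proof -
  have "t \<ge> 0" using \<open>t > 0\<close> by simp
  define r where "r s = distr_of (\<lambda>x. v s x - v t x) (\<lambda>x. dilation a \<phi> s x - dilation a \<phi> t x)" for s
  obtain K where
    K: "\<And>s. s \<ge> 0 \<Longrightarrow> \<bar>s - t\<bar> < 1 \<Longrightarrow> norm (r s) \<le> K * \<bar>s - t\<bar> * L2_norm (\<lambda>x. v s x - v t x)"
    unfolding r_def by (rule heat_solution_pairing_remainder[OF v \<phi> \<open>t \<ge> 0\<close>]) blast
  have at_t: "at t within {0..} = at t"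
    by (rule at_within_interior) (use \<open>t > 0\<close> in simp)
  have L2_cont: "((\<lambda>s. L2_norm (\<lambda>x. v s x - v t x)) \<longlongrightarrow> 0) (at t)"
    using v \<open>t \<ge> 0\<close> unfolding heat_cauchy_solution_def at_t[symmetric] by blast
  have nonneg: "\<forall>\<^sub>F s in at t. s > 0"
    using eventually_at_in_open'[of "{0<..}" t] \<open>t > 0\<close> by simp
  have near: "\<forall>\<^sub>F s in at t. \<bar>s - t\<bar> < 1"
    by (auto simp: eventually_at dist_real_def intro!: exI[of _ 1])
  note test = test_function_dilation[OF \<phi>, of a]
  have loc: "locally_integrable (v t)"
    by (intro in_L2_locally_integrable heat_solution_L2[OF v] \<open>t \<ge> 0\<close>)
  have r': "(r has_vector_derivative 0) (at t)"
    unfolding has_vector_derivative_def has_derivative_at_within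
  proof
    have "((\<lambda>s. r s /\<^sub>R norm (s - t)) \<longlongrightarrow> 0) (at t)"
    proof (rule Lim_null_comparison)
      have "\<forall>\<^sub>F s in at t. s \<noteq> t"
        by (simp add: eventually_at_filter)
      with nonneg near show "\<forall>\<^sub>F s in at t. norm (r s /\<^sub>R norm (s - t)) \<le> K * L2_norm (\<lambda>x. v s x - v t x)"
      proof eventually_elim
        case (elim s)
        then show ?case
          using K[of s] by (simp add: field_simps)
      qed
    qed (use tendsto_mult_left[OF L2_cont, of K] in simp)
    moreover have "r t = 0"
      by (simp add: r_def distr_of_def)
    ultimately show "((\<lambda>s. ((r s - r t) - (s - t) *\<^sub>R 0) /\<^sub>R norm (s - t)) \<longlongrightarrow> 0) (at t)"
      by simp
  qed simp
  have eq: "((\<lambda>s. distr_of (v s) (dilation a \<phi> t)) has_vector_derivative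
      - (a *\<^sub>R distr_of (v t) (deriv (\<lambda>x. x * dilation a \<phi> t x)))) (at t)"
    using v \<open>t > 0\<close> test unfolding heat_cauchy_solution_def euler_op_distr_of[OF test, symmetric] by blast
  have "((\<lambda>s. (distr_of (v s) (dilation a \<phi> t) + (distr_of (v t) (dilation a \<phi> s) - distr_of (v t) (dilation a \<phi> t))) + r s)
    has_vector_derivative (- (a *\<^sub>R distr_of (v t) (deriv (\<lambda>x. x * dilation a \<phi> t x)))
      + (a *\<^sub>R distr_of (v t) (deriv (\<lambda>x. x * dilation a \<phi> t x)) - 0)) + 0) (at t)"
    by (intro has_vector_derivative_add has_vector_derivative_diff has_vector_derivative_const eq r'
        distr_of_dilation_has_derivative loc \<phi>)
  then have "((\<lambda>s. (distr_of (v s) (dilation a \<phi> t) + (distr_of (v t) (dilation a \<phi> s) - distr_of (v t) (dilation a \<phi> t))) + r s)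
    has_vector_derivative 0) (at t)"
    by simp
  then show ?thesis
  proof (rule has_vector_derivative_transform_within_open)
    show "(distr_of (v s) (dilation a \<phi> t) + (distr_of (v t) (dilation a \<phi> s) - distr_of (v t) (dilation a \<phi> t))) + r s
        = distr_of (v s) (dilation a \<phi> s)" if "s \<in> {0<..}" for s
      using heat_solution_pairing_eq[OF v \<phi> _ \<open>t \<ge> 0\<close>, of s] that by (simp add: r_def)
  qed (use \<open>t > 0\<close> in auto)
qed

lemma heat_solution_pairing_constant:
  assumes v: "heat_cauchy_solution a v0 v" and \<phi>: "test_function \<phi>" and "t \<ge> 0"
  shows "distr_of (v t) (dilation a \<phi> t) = distr_of (v 0) \<phi>"
proof -
  have "distr_of (v t) (dilation a \<phi> t) = distr_of (v 0) (dilation a \<phi> 0)"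
  proof (rule has_derivative_zero_unique_strong_interval[where k = "{0}" and a = 0 and b = t and x = t])
    show "continuous_on {0..t} (\<lambda>s. distr_of (v s) (dilation a \<phi> s))"
      unfolding continuous_on_def
      by (intro ballI tendsto_within_subset[OF heat_solution_pairing_continuous[OF v \<phi>]]) auto
    show "((\<lambda>s. distr_of (v s) (dilation a \<phi> s)) has_derivative (\<lambda>h. 0)) (at s within {0..t})"
      if "s \<in> {0..t} - {0}" for s
      using heat_solution_pairing_derivative[OF v \<phi>, of s] that
      by (auto simp: has_vector_derivative_def intro: has_derivative_at_withinI)
  qed (use \<open>t \<ge> 0\<close> in auto)
  then show ?thesis
    by (simp add: dilation_def[abs_def])
qed

lemma heat_solution_unique:
  assumes v0: "in_L2 v0" and v: "heat_cauchy_solution a v0 v" and "t \<ge> 0"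
  shows "AE x in lebesgue. v t x = v0 (exp (a * t) * x)"
proof -
  define u where "u = (\<lambda>x. v0 (exp (a * t) * x))"
  have "in_L2 u"
    unfolding u_def using v0 by (rule in_L2_scale) simp
  then have loc: "locally_integrable (v t)" "locally_integrable u" "locally_integrable (\<lambda>x. v t x - u x)"
    by (intro in_L2_locally_integrable in_L2_diff heat_solution_L2[OF v \<open>t \<ge> 0\<close>]; assumption)+
  have "AE x in lebesgue. v t x - u x = 0"
  proof (rule AE_eq_0_if_test_integrals_eq_0[OF loc(3)])
    fix \<psi> assume \<psi>: "test_function \<psi>"
    \<comment> \<open>Chosen so that its dilation with rate \<open>a\<close> at time \<open>t\<close> is \<open>\<psi>\<close> again.\<close>
    define \<phi> where "\<phi> = dilation (- a) \<psi> t"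
    have \<phi>: "test_function \<phi>"
      unfolding \<phi>_def by (intro test_function_dilation \<psi>)
    have "dilation a \<phi> t = \<psi>"
      by (simp add: \<phi>_def dilation_def fun_eq_iff mult.assoc[symmetric] mult_exp_exp)
    then have "distr_of (v t) \<psi> = distr_of (v 0) \<phi>"
      using heat_solution_pairing_constant[OF v \<phi> \<open>t \<ge> 0\<close>] by simp
    also have "\<dots> = distr_of v0 \<phi>"
      unfolding distr_of_def
    proof (rule integral_cong_AE)
      have "AE x in lebesgue. v 0 x = v0 x"
        using v by (simp add: heat_cauchy_solution_def)
      then show "AE x in lebesgue. v 0 x * complex_of_real (\<phi> x) = v0 x * complex_of_real (\<phi> x)"
        by eventually_elim simp
    qed (intro borel_measurable_integrable integrable_times_test_function \<phi>
          in_L2_locally_integrable v0 heat_solution_L2[OF v] order_refl)+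
    also have "\<dots> = distr_of u \<psi>"
      unfolding u_def \<phi>_def by (rule distr_of_scale[symmetric])
    finally show "(LINT x|lebesgue. (v t x - u x) * complex_of_real (\<psi> x)) = 0"
      using distr_of_diff_left[OF loc(1,2) \<psi>] by (simp add: distr_of_def)
  qed
  then show ?thesis
    by (simp add: u_def)
qed

theorem theorem4p1:
  fixes a :: real and v0 :: "real \<Rightarrow> complex"
  assumes "a > 0" and "in_L2 v0"
  shows "heat_cauchy_solution a v0 (\<lambda>t x. v0 (exp (a * t) * x))
    \<and> (\<forall>v. heat_cauchy_solution a v0 v \<longrightarrow>
          (\<forall>t\<ge>0. AE x in lebesgue. v t x = v0 (exp (a * t) * x)))"
  using dilation_is_heat_solution[OF assms] heat_solution_unique[OF assms(2)] by blast

end
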